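(* Let $G_1$ and $G_2$ be finite perfect simple graphs on $[d]$. Then \[\delta(\Omega(\mathcal{Q}_{G_1},\mathcal{Q}_{G_2}),\lambda)=\delta(\Gamma(\mathcal{Q}_{\widehat{G_1}},\mathcal{Q}_{\widehat{G_2}}),\lambda)=(1+\lambda)\,\delta(\Gamma(\mathcal{Q}_{G_1},\mathcal{Q}_{G_2}),\lambda).\] In particular $\mathrm{vol}(\Omega(\mathcal{Q}_{G_1},\mathcal{Q}_{G_2}))=\mathrm{vol}(\Gamma(\mathcal{Q}_{\widehat{G_1}},\mathcal{Q}_{\widehat{G_2}}))=2\cdot\mathrm{vol}(\Gamma(\mathcal{Q}_{G_1},\mathcal{Q}_{G_2}))$.
   Context: For a graph $G$ on $[d]$, a subset $W\subset[d]$ is stable if it contains no edge of $G$; with $\rho(W)=\sum_{j\in W}\mathbf{e}_j$, the stable set polytope $\mathcal{Q}_G\subset\mathbb{R}^d$ is $\mathrm{conv}\{\rho(W): W\text{ stable}\}$. For $d$-dimensional lattice polytopes $\mathcal{P},\mathcal{Q}\subset\mathbb{R}^d$: $\Gamma(\mathcal{P},\mathcal{Q})=\mathrm{conv}(\mathcal{P}\cup(-\mathcal{Q}))\subset\mathbb{R}^d$ and $\Omega(\mathcal{P},\mathcal{Q})=\mathrm{conv}((\mathcal{P}\times\{1\})\cup(-\mathcal{Q}\times\{-1\}))\subset\mathbb{R}^{d+1}$. The suspension $\widehat{G}$ of $G$ is the graph on $[d+1]$ with edge set $E(G)\cup\{\{i,d+1\}: i\in[d]\}$. A graph is perfect if every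 induced subgraph has chromatic number equal to its maximum clique size. For a lattice polytope $\mathcal{P}\subset\mathbb{R}^N$ of dimension $N$, its Ehrhart $\delta$-polynomial is $\delta(\mathcal{P},\lambda)=(1-\lambda)^{N+1}\left[1+\sum_{n\ge1}|n\mathcal{P}\cap\mathbb{Z}^N|\lambda^n\right]$, and $\mathrm{vol}(\mathcal{P})=\delta(\mathcal{P},1)$ is its normalized volume. *)

theory Defs
  imports "HOL-Analysis.Analysis" "HOL-Computational_Algebra.Polynomial_FPS"
begin

section \<open>Graphs\<close>

text \<open>
  A graph on the vertex set \<open>[d]\<close> is given by its set of edges, each edge being a two-element
  set of vertices; \<open>[d]\<close> itself is a finite type \<open>'v\<close> with \<open>CARD('v) = d\<close>.
  Since induced subgraphs live on proper subsets of \<open>'v\<close>, the chromatic number and the clique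
  number take the vertex set \<open>V\<close> as an explicit argument.
\<close>

definition simple_graph :: "'v set set \<Rightarrow> bool" where
  "simple_graph E \<longleftrightarrow> (\<forall>e\<in>E. card e = 2)"

definition stable :: "'v set set \<Rightarrow> 'v set \<Rightarrow> bool" where
  "stable E W \<longleftrightarrow> (\<forall>e\<in>E. \<not> e \<subseteq> W)"

definition clique :: "'v set set \<Rightarrow> 'v set \<Rightarrow> bool" where
  "clique E C \<longleftrightarrow> (\<forall>u\<in>C. \<forall>v\<in>C. u \<noteq> v \<longrightarrow> {u, v} \<in> E)"

definition induced_edges :: "'v set set \<Rightarrow> 'v set \<Rightarrow> 'v set set" where
  "induced_edges E W = {e \<in> E. e \<subseteq> W}"

definition proper_coloring :: "'v set \<Rightarrow> 'v set set \<Rightarrow> nat \<Rightarrow> ('v \<Rightarrow> nat) \<Rightarrow> bool" where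
  "proper_coloring V E k c \<longleftrightarrow>
     (\<forall>v\<in>V. c v < k) \<and> (\<forall>u\<in>V. \<forall>v\<in>V. {u, v} \<in> E \<longrightarrow> c u \<noteq> c v)"

definition chromatic_number :: "'v set \<Rightarrow> 'v set set \<Rightarrow> nat" where
  "chromatic_number V E = (LEAST k. \<exists>c. proper_coloring V E k c)"

definition clique_number :: "'v set \<Rightarrow> 'v set set \<Rightarrow> nat" where
  "clique_number V E = Max (card ` {C. C \<subseteq> V \<and> clique E C})"

definition perfect_graph :: "'v::finite set set \<Rightarrow> bool" where
  "perfect_graph E \<longleftrightarrow>
     (\<forall>W. chromatic_number W (induced_edges E W) = clique_number W (induced_edges E W))"

text \<open>The suspension vertex \<open>d+1\<close> is \<open>None\<close>, and \<open>i \<in> [d]\<close> becomes \<open>Some i\<close>.\<close>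

definition suspension :: "'v set set \<Rightarrow> 'v option set set" where
  "suspension E = (image Some) ` E \<union> {{Some i, None} | i. True}"


section \<open>Polytopes\<close>

definition rho :: "'v::finite set \<Rightarrow> real^'v" where
  "rho W = (\<Sum>j\<in>W. axis j 1)"

definition stable_set_polytope :: "'v::finite set set \<Rightarrow> (real^'v) set" where
  "stable_set_polytope E = convex hull (rho ` {W. stable E W})"

definition Gamma_polytope :: "(real^'v::finite) set \<Rightarrow> (real^'v) set \<Rightarrow> (real^'v) set" where
  "Gamma_polytope P Q = convex hull (P \<union> uminus ` Q)"

text \<open>
  \<open>\<real>\<^sup>d\<^sup>+\<^sup>1\<close> is \<open>real^('v option)\<close> with \<open>None\<close> indexing the last coordinate;
  \<open>at_height t S\<close> is \<open>S \<times> {t}\<close>.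
\<close>

definition at_height :: "real \<Rightarrow> (real^'v::finite) set \<Rightarrow> (real^('v option)) set" where
  "at_height t S = (\<lambda>x. \<chi> i. case i of None \<Rightarrow> t | Some j \<Rightarrow> x $ j) ` S"

definition Omega_polytope ::
    "(real^'v::finite) set \<Rightarrow> (real^'v) set \<Rightarrow> (real^('v option)) set" where
  "Omega_polytope P Q = convex hull (at_height 1 P \<union> at_height (-1) (uminus ` Q))"


section \<open>Ehrhart delta-polynomial and normalized volume\<close>

definition integer_lattice :: "(real^'n::finite) set" where
  "integer_lattice = {x. \<forall>i. x $ i \<in> \<int>}"

definition ehrhart_count :: "(real^'n::finite) set \<Rightarrow> nat \<Rightarrow> nat" where
  "ehrhart_count P n = card ((\<lambda>x. real n *\<^sub>R x) ` P \<inter> integer_lattice)"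

definition ehrhart_series :: "(real^'n::finite) set \<Rightarrow> int fps" where
  "ehrhart_series P = 1 + Abs_fps (\<lambda>n. if n \<ge> 1 then int (ehrhart_count P n) else 0)"

text \<open>
  For a lattice polytope \<open>P\<close> of full dimension \<open>N = CARD('n)\<close> the power series
  \<open>(1 - \<lambda>)\<^sup>N\<^sup>+\<^sup>1 * ehrhart_series P\<close> is a polynomial (Ehrhart, Stanley);
  \<open>delta_poly P\<close> is that polynomial, unique because \<open>fps_of_poly\<close> is injective.
\<close>

definition delta_poly :: "(real^'n::finite) set \<Rightarrow> int poly" where
  "delta_poly P =
     (THE p. fps_of_poly p = (1 - fps_X) ^ (CARD('n) + 1) * ehrhart_series P)"

lemma delta_poly_eqI:
  fixes P :: "(real^'n::finite) set"
  assumes "fps_of_poly p = (1 - fps_X) ^ (CARD('n) + 1) * ehrhart_series P"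
  shows "delta_poly P = p"
  unfolding delta_poly_def using assms
  by (intro the_equality) (auto simp flip: fps_of_poly_eq_iff)

definition normalized_volume :: "(real^'n::finite) set \<Rightarrow> int" where
  "normalized_volume P = poly (delta_poly P) 1"

end

(*
For a nonnegative integer weight a on the vertices let w_i(a) be the maximal a-weight of a clique
of G_i. Perfection of G_i makes a the sum of w_i(a) incidence vectors of stable sets, so a lies in
s * Q_{G_i} if and only if w_i(a) <= s. With h(z) = w_1(z^+) + w_2(z^-), the n-th dilate of Gamma
contains exactly the lattice points z with h(z) <= n. Over each of these, the n-th dilates of Omega
and of the suspended Gamma both have 2 (n - h(z)) + 1 lattice points (z, r), namely those with
2 w_1(z^+) - n <= r <= n - 2 w_2(z^-) and |r| <= n - h(z), respectively. Summing over z gives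
(1 - X) Ehr(Omega) = (1 + X) Ehr(Gamma).

That (1 - X)^(d+1) Ehr(Gamma) is a polynomial, without which the delta-polynomial would be a junk
value of THE, follows because the lattice points of the n-th dilate of Gamma are an n-fold sumset:
its size has a rational generating function (Khovanskii), and growth at most n^d bounds the order of
the pole at 1.
*)
theory Submission
  imports Defs "HOL-Library.Multiset_Order"
begin

section \<open>Generating functions of sumsets\<close>

definition multiset_down_closed :: "'a multiset set \<Rightarrow> bool" where
  "multiset_down_closed L \<longleftrightarrow> (\<forall>u\<in>L. \<forall>v. v \<subseteq># u \<longrightarrow> v \<in> L)"

definition size_series :: "'a multiset set \<Rightarrow> int fps" where
  "size_series L = Abs_fps (\<lambda>n. int (card {u \<in> L. size u = n}))"

lemma size_series_empty [simp]: "size_series {} = 0"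
  by (simp add: size_series_def fps_eq_iff)

text \<open>A translated orthant with apex \<open>u\<close> and free directions \<open>T\<close>.
  The largest \<open>card T\<close> occurring in a down-closed set bounds the pole order of its size
  series at 1.\<close>

definition multiset_box :: "'a multiset \<Rightarrow> 'a set \<Rightarrow> 'a multiset set" where
  "multiset_box u T = {u + w | w. set_mset w \<subseteq> T}"

lemma nat_seq_mono_subseq:
  fixes s :: "nat \<Rightarrow> nat"
  shows "\<exists>f :: nat \<Rightarrow> nat. strict_mono f \<and> mono (\<lambda>n. s (f n))"
proof -
  obtain f :: "nat \<Rightarrow> nat" where f: "strict_mono f" "monoseq (\<lambda>n. s (f n))"
    using seq_monosub[of s] by blast
  consider "mono (\<lambda>n. s (f n))" | "antimono (\<lambda>n. s (f n))"
    using f(2) by (auto simp: monoseq_iff)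
  then show ?thesis
  proof cases
    case 1
    with f show ?thesis by blast
  next
    case 2
    obtain N where N: "\<And>n. s (f N) \<le> s (f n)"
      using ex_has_least_nat[of "\<lambda>_. True" _ "\<lambda>n. s (f n)"] by blast
    \<comment> \<open>A decreasing sequence of naturals is constant once it has reached its minimum,
      so a tail serves.\<close>
    have "s (f (n + N)) = s (f N)" for n
      using N[of "n + N"] antimonoD[OF 2, of N "n + N"] by simp
    then have "mono (\<lambda>n. s (f (n + N)))" by (simp add: mono_def)
    moreover have "strict_mono (\<lambda>n. f (n + N))"
      using f(1) by (simp add: strict_mono_def)
    ultimately show ?thesis by blast
  qed
qed

text \<open>Dickson's lemma. Subsequences are refined for one element of \<open>A\<close> at a time,
  which preserves the monotonicity already obtained; counts outside \<open>A\<close> vanish.\<close>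

lemma multiset_mono_subseq:
  fixes x :: "nat \<Rightarrow> 'a multiset"
  assumes "finite A" and "\<And>n. set_mset (x n) \<subseteq> A"
  shows "\<exists>r :: nat \<Rightarrow> nat. strict_mono r \<and> (\<forall>i j. i \<le> j \<longrightarrow> x (r i) \<subseteq># x (r j))"
proof -
  have "\<exists>r :: nat \<Rightarrow> nat. strict_mono r \<and> (\<forall>a\<in>A. mono (\<lambda>n. count (x (r n)) a))"
    using assms(1)
  proof induction
    case empty
    show ?case by (rule exI[of _ id]) (simp add: strict_mono_def)
  next
    case (insert a A)
    then obtain r :: "nat \<Rightarrow> nat" where r: "strict_mono r" "\<And>a. a \<in> A \<Longrightarrow> mono (\<lambda>n. count (x (r n)) a)"
      by blast
    obtain f :: "nat \<Rightarrow> nat" where f: "strict_mono f" "mono (\<lambda>n. count (x (r (f n))) a)"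
      using nat_seq_mono_subseq[of "\<lambda>n. count (x (r n)) a"] by blast
    have "mono (\<lambda>n. count (x (r (f n))) c)" if "c \<in> A" for c
      using r(2)[OF that] strict_mono_leD[OF f(1)] by (simp add: mono_def)
    with f r(1) show ?case
      by (intro exI[of _ "\<lambda>n. r (f n)"]) (auto simp: strict_mono_def)
  qed
  then obtain r :: "nat \<Rightarrow> nat" where r: "strict_mono r" "\<And>a. a \<in> A \<Longrightarrow> mono (\<lambda>n. count (x (r n)) a)"
    by blast
  have "x (r i) \<subseteq># x (r j)" if "i \<le> j" for i j
  proof (rule mset_subset_eqI)
    fix a
    show "count (x (r i)) a \<le> count (x (r j)) a"
    proof (cases "a \<in> A")
      case True
      then show ?thesis using r(2) that by (simp add: mono_def)
    next
      case False
      then have "a \<notin># x (r i)" using assms(2) by blast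
      then show ?thesis by (simp add: not_in_iff)
    qed
  qed
  with r(1) show ?thesis by blast
qed

text \<open>The Noetherian property of monomial ideals, read on complements. Were every step strict,
  Dickson's lemma applied to elements lost at each step would put an earlier lost element below a
  later one, which still lies in the smaller set; down-closedness would then bring the lost element
  back.\<close>

lemma multiset_down_closed_chain_stabilizes:
  fixes D :: "nat \<Rightarrow> 'a multiset set"
  assumes "finite A" and "antimono D" and "\<And>k. multiset_down_closed (D k)"
    and "\<And>k u. u \<in> D k \<Longrightarrow> set_mset u \<subseteq> A"
  shows "\<exists>K. D (Suc K) = D K"
proof (rule ccontr)
  assume "\<nexists>K. D (Suc K) = D K"
  moreover have "D (Suc K) \<subseteq> D K" for K
    using antimonoD[OF assms(2), of K "Suc K"] by simp
  ultimately have "\<exists>u. u \<in> D K - D (Suc K)" for K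
    by blast
  then obtain x where x: "\<And>K. x K \<in> D K - D (Suc K)"
    by metis
  have "set_mset (x K) \<subseteq> A" for K
    using assms(4)[of "x K" K] x[of K] by blast
  then obtain r :: "nat \<Rightarrow> nat" where r: "strict_mono r" "\<And>i j. i \<le> j \<Longrightarrow> x (r i) \<subseteq># x (r j)"
    using multiset_mono_subseq[OF assms(1), of x] by blast
  have "Suc (r 0) \<le> r 1"
    using r(1) by (simp add: strict_mono_def Suc_leI)
  then have "D (r 1) \<subseteq> D (Suc (r 0))"
    using antimonoD[OF assms(2)] by blast
  then have "x (r 1) \<in> D (Suc (r 0))"
    using x[of "r 1"] by blast
  moreover have "x (r 0) \<subseteq># x (r 1)" using r(2) by simp
  ultimately have "x (r 0) \<in> D (Suc (r 0))"
    using assms(3) unfolding multiset_down_closed_def by blast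
  with x[of "r 0"] show False by blast
qed

lemma fps_of_poly_one_minus_X: "fps_of_poly [:1, -1:] = (1 - fps_X :: 'a::comm_ring_1 fps)"
  by (auto simp: fps_eq_iff coeff_pCons fps_X_def split: nat.split)

text \<open>Multisets containing \<open>a\<close> arise uniquely by adding one \<open>a\<close> to a
  multiset of size one less, hence the factor \<open>fps_X\<close>.\<close>

lemma size_series_split:
  assumes "finite A" and "\<And>u. u \<in> L \<Longrightarrow> set_mset u \<subseteq> A"
  shows "size_series L =
    size_series {u \<in> L. a \<notin># u} + fps_X * size_series {u. add_mset a u \<in> L}"
proof (rule fps_ext)
  fix n
  have fin: "finite {u \<in> L. size u = n}" for n
    by (rule finite_subset[OF _ finite_multisets_of_size[OF assms(1), of n]])
      (use assms(2) in \<open>auto simp: multisets_of_size_def\<close>)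
  show "fps_nth (size_series L) n =
    fps_nth (size_series {u \<in> L. a \<notin># u} + fps_X * size_series {u. add_mset a u \<in> L}) n"
  proof (cases n)
    case 0
    have "{u \<in> L. size u = 0} = {u \<in> {u \<in> L. a \<notin># u}. size u = 0}" by auto
    then show ?thesis by (simp add: 0 size_series_def)
  next
    case (Suc m)
    let ?P = "{u \<in> {u \<in> L. a \<notin># u}. size u = n}"
    let ?Q = "{u \<in> {u. add_mset a u \<in> L}. size u = m}"
    have eq: "{u \<in> L. size u = n} = ?P \<union> add_mset a ` ?Q"
    proof (intro equalityI subsetI)
      fix u assume u: "u \<in> {u \<in> L. size u = n}"
      show "u \<in> ?P \<union> add_mset a ` ?Q"
      proof (cases "a \<in># u")
        case True
        then obtain v where "u = add_mset a v" by (metis mset_add)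
        with u Suc show ?thesis by auto
      qed (use u in auto)
    qed (use Suc in auto)
    have "card {u \<in> L. size u = n} = card ?P + card (add_mset a ` ?Q)"
      unfolding eq
      by (rule card_Un_disjoint) (use fin[of n] eq in \<open>auto intro: finite_subset\<close>)
    also have "card (add_mset a ` ?Q) = card ?Q"
      by (rule card_image) (simp add: inj_on_def)
    finally show ?thesis by (simp add: Suc size_series_def)
  qed
qed

text \<open>
  The quotients of \<open>L\<close> by powers of \<open>a\<close> form a decreasing chain \<open>D\<close>, which stabilizes at some \<open>D K\<close>. There the
  series is that of the \<open>a\<close>-free part divided by \<open>1 - fps_X\<close>, and a box in the \<open>a\<close>-free part
  gains the direction \<open>a\<close>, so one factor \<open>1 - fps_X\<close> is available for it.
\<close>

lemma size_series_down_closed_rational: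
  assumes "finite A" and "\<And>u. u \<in> L \<Longrightarrow> set_mset u \<subseteq> A" and "multiset_down_closed L"
    and "\<And>u T. multiset_box u T \<subseteq> L \<Longrightarrow> card T \<le> b"
  shows "\<exists>p. fps_of_poly p = (1 - fps_X) ^ b * size_series L"
  using assms
proof (induction A arbitrary: L b rule: finite_induct)
  case empty
  then have "L \<subseteq> {{#}}" by auto
  then consider "L = {}" | "L = {{#}}" by blast
  then show ?case
  proof cases
    case 1
    then have "fps_of_poly 0 = (1 - fps_X) ^ b * size_series L"
      by simp
    then show ?thesis by blast
  next
    case 2
    then have "size_series L = 1"
      by (auto simp: size_series_def fps_eq_iff Collect_conv_if)
    then have "fps_of_poly ([:1, -1:] ^ b) = (1 - fps_X) ^ b * size_series L"
      by (simp add: fps_of_poly_power fps_of_poly_one_minus_X)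
    then show ?thesis by blast
  qed
next
  case (insert a A)
  define D where "D k = {u. u + replicate_mset k a \<in> L}" for k
  have D_sub: "set_mset u \<subseteq> insert a A" if "u \<in> D k" for k u
    using insert.prems(1)[of "u + replicate_mset k a"] that by (auto simp: D_def)
  have D_down: "multiset_down_closed (D k)" for k
    unfolding multiset_down_closed_def D_def
  proof safe
    fix u v assume "u + replicate_mset k a \<in> L" "v \<subseteq># u"
    moreover from this have "v + replicate_mset k a \<subseteq># u + replicate_mset k a" by simp
    ultimately show "v + replicate_mset k a \<in> L"
      using insert.prems(2) unfolding multiset_down_closed_def by blast
  qed
  have D_Suc: "D (Suc k) = {u. add_mset a u \<in> D k}" for k
    by (simp add: D_def)
  have D_dec: "D (Suc k) \<subseteq> D k" for k
  proof
    fix u assume "u \<in> D (Suc k)"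
    then have "add_mset a u \<in> D k" by (simp add: D_Suc)
    then show "u \<in> D k"
      using D_down[of k] unfolding multiset_down_closed_def
      by (metis multi_psub_of_add_self subset_mset.less_imp_le)
  qed
  have "antimono D"
    using D_dec by (simp add: antimono_iff_le_Suc)
  then obtain K where K: "D (Suc K) = D K"
    using multiset_down_closed_chain_stabilizes[of "insert a A" D] insert.hyps(1) D_down D_sub
    by (metis finite.insertI)
  define S where "S k = {u \<in> D k. a \<notin># u}" for k
  have S_sub: "set_mset u \<subseteq> A" if "u \<in> S k" for k u
    using D_sub[of u k] that by (auto simp: S_def)
  have S_down: "multiset_down_closed (S k)" for k
    using D_down[of k] by (auto simp: multiset_down_closed_def S_def dest: mset_subset_eqD)
  \<comment> \<open>Boxes in the quotients shift into \<open>L\<close> with the same directions, so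
    the bound \<open>b\<close> is inherited by every \<open>D k\<close> and
    \<open>S k\<close>.\<close>
  have box_shift: "multiset_box (u + replicate_mset k a) T \<subseteq> L" if "multiset_box u T \<subseteq> D k" for u T k
  proof
    fix x assume "x \<in> multiset_box (u + replicate_mset k a) T"
    then obtain w where w: "set_mset w \<subseteq> T" "x = (u + w) + replicate_mset k a"
      by (auto simp: multiset_box_def ac_simps)
    then have "u + w \<in> D k" using that by (auto simp: multiset_box_def)
    then show "x \<in> L" by (simp add: D_def w(2))
  qed
  have split: "size_series (D k) = size_series (S k) + fps_X * size_series (D (Suc k))" for k
    unfolding S_def D_Suc
    by (rule size_series_split[of "insert a A"]) (use insert.hyps(1) D_sub in auto)
  \<comment> \<open>Induction descends from the stable index \<open>K\<close> to 0, where
    \<open>D 0\<close> is \<open>L\<close>.\<close>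
  have "\<exists>p. fps_of_poly p = (1 - fps_X) ^ b * size_series (D k)" if "k \<le> K" for k
    using that
  proof (induction rule: inc_induct)
    case base
    show ?case
    proof (cases "D K = {}")
      case True
      then have "fps_of_poly 0 = (1 - fps_X) ^ b * size_series (D K)"
        by simp
      then show ?thesis by blast
    next
      case False
      have ser: "(1 - fps_X) * size_series (D K) = size_series (S K)"
        using split[of K] unfolding K by (simp add: algebra_simps)
      have add: "u + replicate_mset m a \<in> D K" if "u \<in> D K" for u m
      proof (induction m)
        case (Suc m)
        then have "u + replicate_mset m a \<in> D (Suc K)" using K by simp
        then show ?case by (simp add: D_Suc)
      qed (use that in simp)
      have box: "card T < b" if T: "multiset_box u T \<subseteq> S K" for u T
      proof -
        have u: "u \<in> S K" using T by (auto simp: multiset_box_def)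
        have "t \<in> A" if "t \<in> T" for t
        proof -
          have "u + {#t#} \<in> S K" using T that by (force simp: multiset_box_def)
          then show ?thesis using S_sub[of _ K] by fastforce
        qed
        then have TA: "T \<subseteq> A" by blast
        have "multiset_box u (insert a T) \<subseteq> D K"
        proof
          fix x assume "x \<in> multiset_box u (insert a T)"
          then obtain w where w: "x = u + w" "set_mset w \<subseteq> insert a T"
            by (auto simp: multiset_box_def)
          define w' where "w' = filter_mset (\<lambda>y. y \<noteq> a) w"
          have ww: "w = w' + replicate_mset (count w a) a"
            by (auto simp: w'_def multiset_eq_iff)
          have "set_mset w' \<subseteq> T" using w(2) by (auto simp: w'_def)
          then have "u + w' \<in> D K" using T by (auto simp: multiset_box_def S_def)
          from add[OF this, of "count w a"] show "x \<in> D K"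
            using w(1) ww by (metis add.assoc)
        qed
        then have "card (insert a T) \<le> b"
          using box_shift insert.prems(3) by blast
        moreover have "card (insert a T) = Suc (card T)"
          using TA insert.hyps finite_subset[of T A] by (subst card_insert_disjoint) auto
        ultimately show ?thesis by simp
      qed
      \<comment> \<open>The singleton box at the empty multiset shows that \<open>b\<close> is
        positive, so one factor can be split off.\<close>
      obtain u where u: "u \<in> D K" using False by blast
      have "{#} \<in> S K"
        using u D_down[of K] by (auto simp: S_def multiset_down_closed_def)
      then have "0 < b"
        using box[of "{#}" "{}"] by (auto simp: multiset_box_def)
      then obtain c where c: "b = Suc c" by (cases b) auto
      have "\<exists>p. fps_of_poly p = (1 - fps_X) ^ c * size_series (S K)"
        by (rule insert.IH[OF S_sub S_down]) (use box c in fastforce)+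
      moreover have "(1 - fps_X) ^ c * size_series (S K) = (1 - fps_X) ^ b * size_series (D K)"
        unfolding c ser[symmetric] by (simp only: power_Suc ac_simps)
      ultimately show ?thesis by simp
    qed
  next
    case (step k)
    obtain p where p: "fps_of_poly p = (1 - fps_X) ^ b * size_series (D (Suc k))"
      using step.IH by blast
    have "\<exists>q. fps_of_poly q = (1 - fps_X) ^ b * size_series (S k)"
    proof (rule insert.IH[OF S_sub S_down])
      fix u T assume "multiset_box u T \<subseteq> S k"
      then have "multiset_box u T \<subseteq> D k" by (auto simp: S_def)
      then show "card T \<le> b" using box_shift insert.prems(3) by blast
    qed
    then obtain q where q: "fps_of_poly q = (1 - fps_X) ^ b * size_series (S k)" by blast
    have "fps_of_poly (q + [:0, 1:] * p) = (1 - fps_X) ^ b * size_series (D k)"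
      unfolding split[of k] by (simp only: fps_of_poly_add fps_of_poly_mult p q fps_of_poly_fps_X)
        (simp add: algebra_simps)
    then show ?case by blast
  qed
  from this[of 0] show ?case by (simp add: D_def)
qed

section \<open>Growth bounds and sumsets\<close>

lemma card_multisets_of_size_ge:
  assumes "finite T" and "t \<notin> T"
  shows "(k + 1) ^ card T \<le> card (multisets_of_size (insert t T) (k * card T))"
proof -
  \<comment> \<open>Multiplicities up to \<open>k\<close> on \<open>T\<close> are chosen freely;
    copies of \<open>t\<close> fill the multiset up to the common size
    \<open>k * card T\<close>.\<close>
  define M where "M f = (\<Sum>i\<in>T. replicate_mset (f i) i) + replicate_mset (k * card T - sum f T) t"
    for f :: "'a \<Rightarrow> nat"
  have cnt: "count (M f) i = f i" if "i \<in> T" for f i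
    using that assms by (auto simp: M_def count_sum if_distrib cong: if_cong)
  have "inj_on M (PiE T (\<lambda>_. {..k}))"
  proof (rule inj_onI)
    fix f g assume fg: "f \<in> PiE T (\<lambda>_. {..k})" "g \<in> PiE T (\<lambda>_. {..k})" "M f = M g"
    show "f = g"
      by (rule PiE_ext[OF fg(1,2)]) (metis cnt fg(3))
  qed
  moreover have "M ` (PiE T (\<lambda>_. {..k})) \<subseteq> multisets_of_size (insert t T) (k * card T)"
  proof safe
    fix f assume f: "f \<in> PiE T (\<lambda>_. {..k})"
    have "sum f T \<le> card T * k"
      using sum_bounded_above[of T f k] f by (auto simp: PiE_iff)
    moreover have "size (\<Sum>i\<in>T. replicate_mset (f i) i) = sum f T"
      using assms(1) by induction auto
    moreover have "set_mset (\<Sum>i\<in>T. replicate_mset (f i) i) \<subseteq> T"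
      using assms(1) by induction auto
    ultimately show "M f \<in> multisets_of_size (insert t T) (k * card T)"
      by (auto simp: multisets_of_size_def M_def mult.commute)
  qed
  ultimately have "card (PiE T (\<lambda>_. {..k})) \<le> card (multisets_of_size (insert t T) (k * card T))"
    using assms(1) by (intro card_inj_on_le) auto
  then show ?thesis using assms(1) by (simp add: card_PiE)
qed

lemma card_le_if_multisets_of_size_bounded:
  assumes "\<And>n. card (multisets_of_size T n) \<le> C * (n + 1) ^ d"
  shows "card T \<le> d + 1"
proof (rule ccontr)
  assume neg: "\<not> card T \<le> d + 1"
  then have "finite T" "T \<noteq> {}" by (auto intro: card_ge_0_finite)
  then obtain t T' where T: "T = insert t T'" "t \<notin> T'" "finite T'"
    by (metis Set.set_insert ex_in_conv finite_insert)
  then have d: "d + 1 \<le> card T'" using neg by simp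
  define m where "m = card T'"
  \<comment> \<open>This \<open>k\<close> makes \<open>C * ((m + 1) * (k + 1)) ^ d\<close> equal to
    \<open>k * (k + 1) ^ d\<close>, just short of the lower bound
    \<open>(k + 1) ^ (d + 1)\<close>.\<close>
  define k where "k = C * (m + 1) ^ d"
  have "(k + 1) ^ d * (k + 1) = (k + 1) ^ (d + 1)" by simp
  also have "\<dots> \<le> (k + 1) ^ m"
    using d unfolding m_def by (intro power_increasing) auto
  also have "\<dots> \<le> C * (k * m + 1) ^ d"
    using card_multisets_of_size_ge[OF T(3,2), of k] assms[of "k * m"]
    unfolding m_def T(1)[symmetric] by linarith
  also have "\<dots> \<le> C * ((m + 1) * (k + 1)) ^ d"
    by (intro mult_left_mono power_mono) (auto simp: algebra_simps)
  also have "\<dots> = (k + 1) ^ d * k"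
    unfolding power_mult_distrib by (simp only: k_def ac_simps)
  finally show False by simp
qed

text \<open>
  Khovanskii's theorem on the growth of sumsets: the least representatives of the sums, with respect
  to a linear order compatible with addition of multisets, form a down-closed set.
\<close>

theorem sumset_series_rational:
  fixes A :: "'b::comm_monoid_add set"
  assumes "finite A"
    and bound: "\<And>n. card (sum_mset ` multisets_of_size A n) \<le> C * (n + 1) ^ d"
  shows "\<exists>p. fps_of_poly p =
    (1 - fps_X) ^ (d + 1) * Abs_fps (\<lambda>n. int (card (sum_mset ` multisets_of_size A n)))"
proof -
  \<comment> \<open>Indexing \<open>A\<close> by naturals makes the multiset order on indices linear
    and compatible with addition.\<close>
  obtain e where e: "bij_betw e {0..<card A} A"
    using ex_bij_betw_nat_finite[OF assms(1)] by blast
  define I where "I = {0..<card A}"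
  define val where "val u = sum_mset (image_mset e u)" for u
  define L where "L = {u. set_mset u \<subseteq> I \<and>
    (\<forall>v. set_mset v \<subseteq> I \<longrightarrow> size v = size u \<longrightarrow> val v = val u \<longrightarrow> u \<le> v)}"
  have down: "multiset_down_closed L"
    unfolding multiset_down_closed_def
  proof safe
    fix u v assume u: "u \<in> L" and "v \<subseteq># u"
    then obtain w where w: "u = v + w" by (metis subset_mset.add_diff_inverse)
    show "v \<in> L" unfolding L_def
    proof (safe)
      show "x \<in> I" if "x \<in># v" for x using u that by (auto simp: L_def w)
      fix v' assume v': "set_mset v' \<subseteq> I" "size v' = size v" "val v' = val v"
      moreover have "set_mset w \<subseteq> I" using u by (auto simp: L_def w)
      moreover have min: "u \<le> x" if "set_mset x \<subseteq> I" "size x = size u" "val x = val u" for x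
        using u that by (simp add: L_def)
      ultimately have "u \<le> v' + w"
        \<comment> \<open>Replacing \<open>v\<close> by \<open>v'\<close> inside \<open>u\<close>
          keeps size and value, so minimality of \<open>u\<close> applies and \<open>w\<close>
          cancels.\<close>
        by (intro min) (simp_all add: w val_def)
      then show "v \<le> v'" unfolding w by (rule add_le_imp_le_right)
    qed
  qed
  have inj: "inj_on val {u \<in> L. size u = n}" for n
    by (rule inj_onI) (auto simp: L_def intro: antisym)
  have img: "val ` {u \<in> L. size u = n} = sum_mset ` multisets_of_size A n" for n
  proof (intro equalityI subsetI)
    fix y assume "y \<in> val ` {u \<in> L. size u = n}"
    then obtain u where u: "u \<in> L" "size u = n" "y = val u" by blast
    then have "image_mset e u \<in> multisets_of_size A n"
      using e by (auto simp: multisets_of_size_def L_def I_def bij_betw_def)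
    then show "y \<in> sum_mset ` multisets_of_size A n" using u(3) by (auto simp: val_def)
  next
    fix y assume "y \<in> sum_mset ` multisets_of_size A n"
    then obtain w where w: "set_mset w \<subseteq> A" "size w = n" "y = sum_mset w"
      by (auto simp: multisets_of_size_def)
    define g where "g = inv_into I e"
    have g: "g x \<in> I" "e (g x) = x" if "x \<in> A" for x
      using e that bij_betw_inv_into_right[OF e] inv_into_into[of x e I]
      by (auto simp: g_def I_def bij_betw_def)
    have "image_mset e (image_mset g w) = image_mset id w"
      unfolding multiset.map_comp by (rule image_mset_cong) (use w(1) g in auto)
    then have "val (image_mset g w) = y" by (simp add: val_def w(3))
    moreover have "set_mset (image_mset g w) \<subseteq> I" using g(1) w(1) by auto
    moreover have "size (image_mset g w) = n" by (simp add: w(2))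
    ultimately have "image_mset g w \<in> {u \<in> multisets_of_size I n. val u = y}"
      by (simp add: multisets_of_size_def)
    then have ne: "{u \<in> multisets_of_size I n. val u = y} \<noteq> {}" (is "?F \<noteq> {}")
      by blast
    have fin: "finite ?F"
      by (rule finite_subset[OF _ finite_multisets_of_size[of I n]]) (auto simp: I_def)
    from Min_in[OF fin ne] have m: "Min ?F \<in> ?F" .
    have "Min ?F \<in> L"
      unfolding L_def
    proof (safe)
      show "x \<in> I" if "x \<in># Min ?F" for x
        using m that by (auto simp: multisets_of_size_def)
      fix v assume "set_mset v \<subseteq> I" "size v = size (Min ?F)" "val v = val (Min ?F)"
      then have "v \<in> ?F" using m by (auto simp: multisets_of_size_def)
      then show "Min ?F \<le> v" by (rule Min_le[OF fin])
    qed
    with m show "y \<in> val ` {u \<in> L. size u = n}"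
      by (intro image_eqI[of _ _ "Min ?F"]) (auto simp: multisets_of_size_def)
  qed
  have card: "card {u \<in> L. size u = n} = card (sum_mset ` multisets_of_size A n)" for n
    using card_image[OF inj, of n] img[of n] by simp
  have finL: "finite {u \<in> L. size u = n}" for n
    by (rule finite_subset[OF _ finite_multisets_of_size[of I n]])
      (auto simp: multisets_of_size_def L_def I_def)
  \<comment> \<open>A box places \<open>card (multisets_of_size T n)\<close> elements at size
    \<open>size u + n\<close>, so polynomial growth limits its directions. The shift by
    \<open>size u\<close> is absorbed into the constant.\<close>
  have "card T \<le> d + 1" if box: "multiset_box u T \<subseteq> L" for u T
  proof (rule card_le_if_multisets_of_size_bounded)
    fix n
    have "(\<lambda>w. u + w) ` multisets_of_size T n \<subseteq> {v \<in> L. size v = size u + n}"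
      using box by (auto simp: multiset_box_def multisets_of_size_def)
    then have "card (multisets_of_size T n) \<le> card {v \<in> L. size v = size u + n}"
      by (intro card_inj_on_le[of "\<lambda>w. u + w"] finL) (auto simp: inj_on_def)
    also have "\<dots> \<le> C * (size u + n + 1) ^ d"
      unfolding card by (rule bound)
    also have "\<dots> \<le> C * ((size u + 1) * (n + 1)) ^ d"
      by (intro mult_left_mono power_mono) auto
    finally show "card (multisets_of_size T n) \<le> (C * (size u + 1) ^ d) * (n + 1) ^ d"
      by (simp only: power_mult_distrib mult.assoc)
  qed
  then have "\<exists>p. fps_of_poly p = (1 - fps_X) ^ (d + 1) * size_series L"
    by (intro size_series_down_closed_rational[of I] down) (auto simp: L_def I_def)
  then show ?thesis unfolding size_series_def card .
qed

section \<open>Stable set decompositions of vertex weights\<close>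

definition max_clique_weight :: "'v::finite set set \<Rightarrow> ('v \<Rightarrow> nat) \<Rightarrow> nat" where
  "max_clique_weight E a = Max (sum a ` {C. clique E C})"

definition stable_decomposition :: "'v set set \<Rightarrow> ('v \<Rightarrow> nat) \<Rightarrow> 'v set multiset \<Rightarrow> bool" where
  "stable_decomposition E a F \<longleftrightarrow>
     (\<forall>S\<in>#F. stable E S) \<and> (\<forall>v. size {#S \<in># F. v \<in> S#} = a v)"

text \<open>The weighted form of perfection. It is a separate notion because it passes to
  suspensions directly, without a proof that the suspension is perfect.\<close>

definition stable_decomposable :: "'v::finite set set \<Rightarrow> bool" where
  "stable_decomposable E \<longleftrightarrow> (\<forall>a. \<exists>F. stable_decomposition E a F \<and> size F = max_clique_weight E a)"

lemma clique_empty [simp]: "clique E {}"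
  by (simp add: clique_def)

lemma clique_weight_le: "clique E C \<Longrightarrow> sum a C \<le> max_clique_weight E a"
  unfolding max_clique_weight_def by (rule Max_ge) auto

lemma max_clique_weight_attained: "\<exists>C. clique E C \<and> max_clique_weight E a = sum a C"
proof -
  have "max_clique_weight E a \<in> sum a ` {C. clique E C}"
    unfolding max_clique_weight_def by (rule Max_in) (auto intro: clique_empty)
  then show ?thesis by auto
qed

lemma max_clique_weight_le:
  assumes "\<And>C. clique E C \<Longrightarrow> sum a C \<le> k"
  shows "max_clique_weight E a \<le> k"
  using max_clique_weight_attained[of E a] assms by auto

lemma weight_le_max_clique_weight: "a v \<le> max_clique_weight E a"
  using clique_weight_le[of E "{v}" a] by (simp add: clique_def)

lemma card_clique_Int_stable_le:
  assumes "clique E C" and "stable E S"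
  shows "card (C \<inter> S) \<le> 1"
proof -
  have "u = v" if "u \<in> C \<inter> S" "v \<in> C \<inter> S" for u v
    using assms that unfolding clique_def stable_def by (metis Int_iff empty_subsetI insert_subset)
  then show ?thesis by (metis One_nat_def card_le_Suc0_iff_eq card.infinite le0)
qed

text \<open>Double counting of the pairs of a vertex of \<open>C\<close> and a class containing
  it.\<close>

lemma stable_decomposition_sum:
  assumes "stable_decomposition E a F" and "finite C"
  shows "sum a C = (\<Sum>S\<in>#F. card (C \<inter> S))"
proof -
  have "(\<Sum>v\<in>C. size {#S \<in># F. v \<in> S#}) = (\<Sum>S\<in>#F. card (C \<inter> S))"
  proof (induction F)
    case (add S F)
    have "(\<Sum>v\<in>C. size {#S' \<in># add_mset S F. v \<in> S'#}) =
        (\<Sum>v\<in>C. of_bool (v \<in> S)) + (\<Sum>v\<in>C. size {#S \<in># F. v \<in> S#})"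
      by (subst sum.distrib[symmetric]) (intro sum.cong, auto)
    also have "(\<Sum>v\<in>C. of_bool (v \<in> S)) = card (C \<inter> S)"
      using assms(2) by (simp add: sum_of_bool_eq Int_def)
    finally show ?case using add by simp
  qed simp
  then show ?thesis using assms(1) by (simp add: stable_decomposition_def)
qed

lemma stable_decomposition_weight_le:
  fixes E :: "'v::finite set set"
  assumes "stable_decomposition E a F"
  shows "max_clique_weight E a \<le> size F"
proof (rule max_clique_weight_le)
  fix C assume C: "clique E C"
  have "(\<Sum>S\<in>#F. card (C \<inter> S)) \<le> (\<Sum>S\<in>#F. 1)"
    using assms C by (intro sum_mset_mono card_clique_Int_stable_le)
      (auto simp: stable_decomposition_def)
  then show "sum a C \<le> size F"
    using stable_decomposition_sum[OF assms, of C] by simp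
qed

text \<open>The colour classes of an optimal colouring of the subgraph induced on \<open>W\<close>
  form the decomposition, and perfection equates their number with the weight of a largest clique in
  \<open>W\<close>.\<close>

lemma perfect_stable_decomposition_indicator:
  fixes E :: "'v::finite set set"
  assumes "simple_graph E" and "perfect_graph E"
  shows "\<exists>F. stable_decomposition E (\<lambda>v. of_bool (v \<in> W)) F \<and>
    size F = max_clique_weight E (\<lambda>v. of_bool (v \<in> W))"
proof -
  let ?a = "\<lambda>v. of_bool (v \<in> W) :: nat"
  define k where "k = clique_number W (induced_edges E W)"
  have edge: "u \<noteq> v" if "{u, v} \<in> E" for u v
    using assms(1) that by (auto simp: simple_graph_def)
  \<comment> \<open>An injective colouring is proper, so the \<open>LEAST\<close> in the chromatic
    number is attained.\<close>
  obtain f :: "'v \<Rightarrow> nat" where "inj f"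
    using finite_imp_inj_to_nat_seg[of "UNIV :: 'v set"] by auto
  then have "proper_coloring W (induced_edges E W) (Suc (Max (range f))) f"
    using edge by (auto simp: proper_coloring_def induced_edges_def inj_def less_Suc_eq_le)
  then have "\<exists>k c. proper_coloring W (induced_edges E W) k c" by blast
  then have "\<exists>c. proper_coloring W (induced_edges E W) (chromatic_number W (induced_edges E W)) c"
    unfolding chromatic_number_def by (rule LeastI_ex)
  then obtain c where c: "proper_coloring W (induced_edges E W) k c"
    using assms(2) by (auto simp: perfect_graph_def k_def)
  \<comment> \<open>Empty colour classes are kept, so that \<open>F\<close> has exactly
    \<open>k\<close> entries.\<close>
  define F where "F = image_mset (\<lambda>i. {v \<in> W. c v = i}) (mset_set {..<k})"
  have "stable_decomposition E ?a F"
    unfolding stable_decomposition_def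
  proof (intro conjI ballI allI)
    fix S assume "S \<in># F"
    then obtain i where S: "S = {v \<in> W. c v = i}" by (auto simp: F_def)
    show "stable E S"
      unfolding stable_def
    proof safe
      fix e assume e: "e \<in> E" "e \<subseteq> S"
      then obtain u v where uv: "e = {u, v}"
        using assms(1) by (auto simp: simple_graph_def card_2_iff)
      then have "{u, v} \<in> induced_edges E W" "u \<in> W" "v \<in> W" "c u = c v"
        using e by (auto simp: S induced_edges_def)
      then show False using c by (auto simp: proper_coloring_def)
    qed
  next
    fix v
    have "size {#S \<in># F. v \<in> S#} = card {i \<in> {..<k}. v \<in> W \<and> c v = i}"
      by (simp add: F_def filter_mset_image_mset filter_mset_mset_set)
    also have "{i \<in> {..<k}. v \<in> W \<and> c v = i} = (if v \<in> W then {c v} else {})"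
      using c by (auto simp: proper_coloring_def)
    finally show "size {#S \<in># F. v \<in> S#} = ?a v" by simp
  qed
  moreover have "size F = max_clique_weight E ?a"
  proof (rule antisym)
    have "k \<in> card ` {C. C \<subseteq> W \<and> clique (induced_edges E W) C}"
      unfolding k_def clique_number_def by (rule Max_in) (auto intro: clique_empty)
    then obtain C where C: "C \<subseteq> W" "clique (induced_edges E W) C" "k = card C" by blast
    then have "clique E C" by (auto simp: clique_def induced_edges_def)
    moreover have "sum ?a C = card C"
      using C(1) by (simp add: sum_of_bool_eq Int_absorb2 subset_eq)
    ultimately show "size F \<le> max_clique_weight E ?a"
      using clique_weight_le[of E C ?a] C(3) by (simp add: F_def)
  qed (rule stable_decomposition_weight_le, fact)
  ultimately show ?thesis by blast
qed

text \<open>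
  This is Lovasz's replication argument. Lower the weight of a vertex \<open>v\<close> of weight at least 2 by one
  and decompose. If the maximal clique weight dropped, add the class \<open>{v}\<close>. Otherwise remove a class
  \<open>S\<close> containing \<open>v\<close> from the original weights: the cliques that meet \<open>S\<close> lose weight, and those that
  avoid \<open>S\<close> also avoid \<open>v\<close> and are covered by one class less.
\<close>

lemma perfect_imp_stable_decomposable:
  fixes E :: "'v::finite set set"
  assumes "simple_graph E" and "perfect_graph E"
  shows "stable_decomposable E"
  unfolding stable_decomposable_def
proof
  fix a :: "'v \<Rightarrow> nat"
  show "\<exists>F. stable_decomposition E a F \<and> size F = max_clique_weight E a"
  proof (induction "sum a UNIV" arbitrary: a rule: less_induct)
    case less
    show ?case
    proof (cases "\<exists>v. a v \<ge> 2")
      case False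
      then have "a = (\<lambda>v. of_bool (v \<in> {v. a v = 1}))"
        by (auto simp: fun_eq_iff) (metis One_nat_def less_2_cases not_le)
      then show ?thesis
        using perfect_stable_decomposition_indicator[OF assms, of "{v. a v = 1}"] by metis
    next
      case True
      then obtain v where v: "a v \<ge> 2" by blast
      define a' where "a' = a(v := a v - 1)"
      have a': "a u = a' u + of_bool (u = v)" for u
        using v by (auto simp: a'_def)
      have sum_a': "sum a C = sum a' C + of_bool (v \<in> C)" for C
        by (simp add: a' sum.distrib)
      have "sum a' UNIV < sum a UNIV" by (simp add: sum_a')
      from less[OF this] obtain F where F: "stable_decomposition E a' F"
        "size F = max_clique_weight E a'" by blast
      show ?thesis
      proof (cases "max_clique_weight E a \<le> max_clique_weight E a'")
        case False
        have "stable E {v}"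
          using assms(1) by (auto simp: stable_def simple_graph_def subset_singleton_iff)
        then have dec: "stable_decomposition E a (add_mset {v} F)"
          using F(1) by (auto simp: stable_decomposition_def a')
        moreover have "size (add_mset {v} F) = max_clique_weight E a"
          using stable_decomposition_weight_le[OF dec] False F(2) by simp
        ultimately show ?thesis by blast
      next
        case True
        have "size {#S \<in># F. v \<in> S#} = a' v"
          using F(1) by (simp add: stable_decomposition_def)
        then have "size {#S \<in># F. v \<in> S#} \<noteq> 0" using v by (simp add: a'_def)
        then have "{#S \<in># F. v \<in> S#} \<noteq> {#}" by (metis size_empty)
        then obtain S where "S \<in># {#S \<in># F. v \<in> S#}" by (metis multiset_nonemptyE)
        then have S: "S \<in># F" "v \<in> S" by simp_all
        then obtain F' where F': "F = add_mset S F'" by (metis mset_add)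
        have stS: "stable E S" using F(1) S(1) by (simp add: stable_decomposition_def)
        define b where "b u = a u - of_bool (u \<in> S)" for u
        \<comment> \<open>Each vertex of the class \<open>S\<close> has positive weight under
          \<open>a'\<close>, so the truncated subtraction in \<open>b\<close> is exact.\<close>
        have "of_bool (u \<in> S) \<le> a' u" for u
          using F(1) unfolding F' stable_decomposition_def
          by (metis (full_types) filter_mset_add_mset of_bool_def size_add_mset
              le_add1 plus_1_eq_Suc zero_le)
        then have b: "a u = b u + of_bool (u \<in> S)" for u
          using le_trans[of "of_bool (u \<in> S)" "a' u" "a u"] by (simp add: b_def a')
        have sum_b: "sum a C = sum b C + card (C \<inter> S)" for C
          by (simp add: b sum.distrib sum_of_bool_eq Int_def)
        have "card S \<noteq> 0" using S(2) by (auto simp: card_eq_0_iff)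
        then have "sum b UNIV < sum a UNIV" by (simp add: sum_b card_gt_0_iff)
        from less[OF this] obtain H where H: "stable_decomposition E b H"
          "size H = max_clique_weight E b" by blast
        have "max_clique_weight E b \<le> size F'"
        proof (rule max_clique_weight_le)
          fix C assume C: "clique E C"
          show "sum b C \<le> size F'"
          proof (cases "C \<inter> S = {}")
            case True
            then have "v \<notin> C" using S(2) by blast
            have "sum b C = sum a' C"
              using sum_b[of C] sum_a'[of C] True \<open>v \<notin> C\<close> by simp
            also have "\<dots> = (\<Sum>T\<in>#F'. card (C \<inter> T))"
              using stable_decomposition_sum[OF F(1), of C] True by (simp add: F')
            also have "\<dots> \<le> (\<Sum>T\<in>#F'. 1)"
              using F(1) C by (intro sum_mset_mono card_clique_Int_stable_le)
                (auto simp: stable_decomposition_def F')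
            finally show ?thesis by simp
          next
            case False
            then have "0 < card (C \<inter> S)" by (simp add: card_gt_0_iff)
            moreover have "sum a C \<le> size F"
              using clique_weight_le[OF C, of a] True F(2) by simp
            moreover have "size F = Suc (size F')" by (simp add: F')
            ultimately show ?thesis using sum_b[of C] by linarith
          qed
        qed
        moreover have dec: "stable_decomposition E a (add_mset S H)"
          using H(1) stS by (auto simp: stable_decomposition_def b)
        moreover have "max_clique_weight E a \<ge> size F"
          unfolding F(2)
          by (rule max_clique_weight_le) (metis sum_a' clique_weight_le le_add1 le_trans)
        ultimately have "size (add_mset S H) = max_clique_weight E a"
          using stable_decomposition_weight_le[OF dec] H(2) True F(2) F' by simp
        with dec show ?thesis by blast
      qed
    qed
  qed
qed

section \<open>Cliques and decompositions of the suspension\<close>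

lemma Some_image_mem_suspension: "Some ` e \<in> suspension E \<longleftrightarrow> e \<in> E"
proof -
  have "Some ` e \<noteq> {Some i, None}" for i by auto
  then show ?thesis by (auto simp: suspension_def inj_image_eq_iff)
qed

lemma clique_suspension_iff: "clique (suspension E) C \<longleftrightarrow> clique E (Some -` C)"
proof
  assume C: "clique (suspension E) C"
  show "clique E (Some -` C)"
    unfolding clique_def
  proof safe
    fix u v assume "Some u \<in> C" "Some v \<in> C" "u \<noteq> v"
    then have "Some ` {u, v} \<in> suspension E" using C by (simp add: clique_def)
    then show "{u, v} \<in> E" by (simp only: Some_image_mem_suspension)
  qed
next
  assume C: "clique E (Some -` C)"
  show "clique (suspension E) C"
    unfolding clique_def
  proof safe
    fix x y assume xy: "x \<in> C" "y \<in> C" "x \<noteq> y"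
    show "{x, y} \<in> suspension E"
    proof (cases x; cases y)
      fix u v assume uv: "x = Some u" "y = Some v"
      then have "{u, v} \<in> E" using C xy by (simp add: clique_def)
      then have "Some ` {u, v} \<in> suspension E" by (simp only: Some_image_mem_suspension)
      then show ?thesis by (simp add: uv)
    qed (use xy in \<open>auto simp: suspension_def insert_commute\<close>)
  qed
qed

lemma sum_option_set:
  fixes a :: "'v::finite option \<Rightarrow> nat"
  shows "sum a C = sum (\<lambda>v. a (Some v)) (Some -` C) + of_bool (None \<in> C) * a None"
proof -
  have "C = Some ` (Some -` C) \<union> (C \<inter> {None})"
    by (auto simp: image_iff)
  then have "sum a C = sum a (Some ` (Some -` C) \<union> (C \<inter> {None}))" by metis
  also have "\<dots> = sum a (Some ` (Some -` C)) + sum a (C \<inter> {None})"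
    by (rule sum.union_disjoint) auto
  also have "sum a (Some ` (Some -` C)) = sum (\<lambda>v. a (Some v)) (Some -` C)"
    by (subst sum.reindex) auto
  finally show ?thesis by (cases "None \<in> C") auto
qed

text \<open>The apex \<open>None\<close> is adjacent to all other vertices and extends every clique,
  so its weight is simply added.\<close>

lemma max_clique_weight_suspension:
  "max_clique_weight (suspension E) a = max_clique_weight E (\<lambda>v. a (Some v)) + a None"
proof (rule antisym)
  show "max_clique_weight (suspension E) a \<le> max_clique_weight E (\<lambda>v. a (Some v)) + a None"
  proof (rule max_clique_weight_le)
    fix C assume "clique (suspension E) C"
    then have "sum (\<lambda>v. a (Some v)) (Some -` C) \<le> max_clique_weight E (\<lambda>v. a (Some v))"
      by (intro clique_weight_le) (simp add: clique_suspension_iff)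
    then show "sum a C \<le> max_clique_weight E (\<lambda>v. a (Some v)) + a None"
      unfolding sum_option_set[of a C] by (intro add_mono) auto
  qed
  obtain C where C: "clique E C" "max_clique_weight E (\<lambda>v. a (Some v)) = sum (\<lambda>v. a (Some v)) C"
    using max_clique_weight_attained by blast
  have vim: "Some -` insert None (Some ` C) = C" by auto
  then have "clique (suspension E) (insert None (Some ` C))"
    using C(1) by (simp add: clique_suspension_iff)
  from clique_weight_le[OF this, of a]
  show "max_clique_weight E (\<lambda>v. a (Some v)) + a None \<le> max_clique_weight (suspension E) a"
    unfolding sum_option_set[of a "insert None (Some ` C)"] vim by (simp add: C(2))
qed

text \<open>Classes of the base graph are reused and \<open>a None\<close> copies of
  \<open>{None}\<close> are added, which matches the additive clique weight.\<close>

lemma stable_decomposable_suspension: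
  fixes E :: "'v::finite set set"
  assumes "simple_graph E" and "stable_decomposable E"
  shows "stable_decomposable (suspension E)"
  unfolding stable_decomposable_def
proof
  fix a :: "'v option \<Rightarrow> nat"
  obtain F where F: "stable_decomposition E (\<lambda>v. a (Some v)) F"
    "size F = max_clique_weight E (\<lambda>v. a (Some v))"
    using assms(2) unfolding stable_decomposable_def by blast
  define H where "H = image_mset (image Some) F + replicate_mset (a None) {None}"
  have stable_Some: "stable (suspension E) (Some ` S)" if "stable E S" for S
    using that unfolding stable_def suspension_def by (auto simp: inj_image_subset_iff)
  have "card e = 2" if "e \<in> suspension E" for e
    using that assms(1) by (auto simp: suspension_def simple_graph_def card_image)
  then have "stable (suspension E) {None}"
    unfolding stable_def by (fastforce simp: subset_singleton_iff)
  then have "stable (suspension E) S" if "S \<in># H" for S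
    using that F(1) stable_Some by (auto simp: H_def stable_decomposition_def split: if_splits)
  moreover have "size {#S \<in># H. v \<in> S#} = a v" for v
  proof (cases v)
    case None
    have "{#S \<in># replicate_mset m {None :: 'v option}. None \<in> S#} = replicate_mset m {None}" for m
      by (induction m) auto
    with None show ?thesis by (simp add: H_def filter_mset_image_mset)
  next
    case (Some u)
    then show ?thesis using F(1)
      by (simp add: H_def filter_mset_image_mset stable_decomposition_def inj_image_mem_iff)
  qed
  ultimately have "stable_decomposition (suspension E) a H"
    by (simp add: stable_decomposition_def)
  moreover have "size H = max_clique_weight (suspension E) a"
    by (simp add: H_def F(2) max_clique_weight_suspension)
  ultimately show "\<exists>F. stable_decomposition (suspension E) a F \<and> size F = max_clique_weight (suspension E) a"
    by blast
qed

section \<open>Lattice points of the polytopes\<close>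

definition lattice_vec :: "('n::finite \<Rightarrow> int) \<Rightarrow> real^'n" where
  "lattice_vec z = (\<chi> i. of_int (z i))"

lemma lattice_vec_nth [simp]: "lattice_vec z $ i = of_int (z i)"
  by (simp add: lattice_vec_def)

lemma inj_lattice_vec: "inj lattice_vec"
  by (rule injI) (simp add: vec_eq_iff fun_eq_iff)

lemma range_lattice_vec: "range lattice_vec = integer_lattice"
proof (intro equalityI subsetI)
  fix x :: "real^'a" assume "x \<in> integer_lattice"
  then have "x = lattice_vec (\<lambda>i. \<lfloor>x $ i\<rfloor>)"
    by (auto simp: integer_lattice_def vec_eq_iff)
  then show "x \<in> range lattice_vec" by blast
qed (auto simp: integer_lattice_def)

text \<open>Counting integer-valued functions instead of real vectors makes it easy to take positive
  parts and to split off the \<open>None\<close> coordinate.\<close>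

lemma ehrhart_count_eq:
  "ehrhart_count P n = card {z. lattice_vec z \<in> (*\<^sub>R) (real n) ` P}"
proof -
  have "(*\<^sub>R) (real n) ` P \<inter> integer_lattice = lattice_vec ` {z. lattice_vec z \<in> (*\<^sub>R) (real n) ` P}"
    unfolding range_lattice_vec[symmetric] image_vimage_eq[symmetric] vimage_def ..
  then show ?thesis
    unfolding ehrhart_count_def
    using card_image[OF inj_on_subset[OF inj_lattice_vec subset_UNIV]] by metis
qed

lemma ehrhart_series_eq:
  assumes "P \<noteq> {}"
  shows "ehrhart_series P = Abs_fps (\<lambda>n. int (ehrhart_count P n))"
proof -
  have "(\<lambda>x. real 0 *\<^sub>R x) ` P \<inter> integer_lattice = {0}"
    using assms by (auto simp: integer_lattice_def)
  then have "ehrhart_count P 0 = 1" by (simp add: ehrhart_count_def)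
  then show ?thesis by (auto simp: ehrhart_series_def fps_eq_iff not_le)
qed

text \<open>The hull of two convex sets is the union of the segments joining them; \<open>s\<close>
  and \<open>t\<close> are the segment coefficients multiplied by \<open>r\<close>. For
  \<open>r = 0\<close> both vanish and cannot be normalized, hence the case split.\<close>

lemma scaled_convex_hull_union:
  fixes S T :: "'m::euclidean_space set"
  assumes "convex S" "S \<noteq> {}" "convex T" "T \<noteq> {}" and "0 \<le> r"
  shows "x \<in> (*\<^sub>R) r ` (convex hull (S \<union> T)) \<longleftrightarrow>
    (\<exists>s t p q. 0 \<le> s \<and> 0 \<le> t \<and> s + t = r \<and> p \<in> S \<and> q \<in> T \<and> x = s *\<^sub>R p + t *\<^sub>R q)"
proof
  assume "x \<in> (*\<^sub>R) r ` (convex hull (S \<union> T))"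
  then obtain u v p q where *: "0 \<le> u" "0 \<le> v" "u + v = 1" "p \<in> S" "q \<in> T"
    "x = r *\<^sub>R (u *\<^sub>R p + v *\<^sub>R q)"
    unfolding convex_hull_union_two[OF assms(1-4)] by blast
  have "r * u + r * v = r" using *(3) by (metis distrib_left mult.right_neutral)
  moreover have "x = (r * u) *\<^sub>R p + (r * v) *\<^sub>R q" using *(6) by (simp add: scaleR_add_right)
  ultimately show "\<exists>s t p q. 0 \<le> s \<and> 0 \<le> t \<and> s + t = r \<and> p \<in> S \<and> q \<in> T \<and> x = s *\<^sub>R p + t *\<^sub>R q"
    using * assms(5) by (metis mult_nonneg_nonneg)
next
  assume "\<exists>s t p q. 0 \<le> s \<and> 0 \<le> t \<and> s + t = r \<and> p \<in> S \<and> q \<in> T \<and> x = s *\<^sub>R p + t *\<^sub>R q"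
  then obtain s t p q where *: "0 \<le> s" "0 \<le> t" "s + t = r" "p \<in> S" "q \<in> T" "x = s *\<^sub>R p + t *\<^sub>R q"
    by blast
  show "x \<in> (*\<^sub>R) r ` (convex hull (S \<union> T))"
  proof (cases "r = 0")
    case True
    then have "x = 0" using * by (simp add: add_nonneg_eq_0_iff)
    moreover have "p \<in> convex hull (S \<union> T)" using *(4) by (simp add: hull_inc)
    ultimately show ?thesis using True by force
  next
    case False
    then have "0 \<le> s / r" "0 \<le> t / r" "s / r + t / r = 1"
      using * assms(5) by (simp_all flip: add_divide_distrib)
    then have "(s / r) *\<^sub>R p + (t / r) *\<^sub>R q \<in> convex hull (S \<union> T)"
      using *(4,5) unfolding convex_hull_union_two[OF assms(1-4)] by blast
    moreover have "x = r *\<^sub>R ((s / r) *\<^sub>R p + (t / r) *\<^sub>R q)"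
      using *(6) False by (simp add: scaleR_add_right)
    ultimately show ?thesis by blast
  qed
qed

lemma sum_mset_in_scaled_convex:
  assumes "convex K" and "K \<noteq> {}" and "\<And>x. x \<in># w \<Longrightarrow> f x \<in> K"
  shows "(\<Sum>x\<in>#w. f x) \<in> (*\<^sub>R) (real (size w)) ` K"
  using assms(3)
proof (induction w)
  case empty
  then show ?case using assms(2) by force
next
  case (add x w)
  then obtain p where p: "p \<in> K" "(\<Sum>x\<in>#w. f x) = real (size w) *\<^sub>R p" by auto
  let ?n = "real (size w)"
  have "(?n / (?n + 1)) *\<^sub>R p + (1 / (?n + 1)) *\<^sub>R f x \<in> K"
    by (rule convexD[OF assms(1) p(1)]) (use add.prems in \<open>auto simp flip: add_divide_distrib\<close>)
  moreover have "(\<Sum>x\<in>#add_mset x w. f x) =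
      real (size (add_mset x w)) *\<^sub>R ((?n / (?n + 1)) *\<^sub>R p + (1 / (?n + 1)) *\<^sub>R f x)"
    by (simp add: p(2) scaleR_add_right add.commute)
  ultimately show ?case by blast
qed

section \<open>Clique inequalities and dilates of the stable set polytope\<close>

lemma rho_nth: "rho W $ v = of_bool (v \<in> W)"
  by (simp add: rho_def axis_def if_distrib cong: if_cong)

lemma rho_empty [simp]: "rho {} = 0"
  by (simp add: rho_def)

lemma convex_stable_set_polytope: "convex (stable_set_polytope E)"
  by (simp add: stable_set_polytope_def)

lemma rho_in_stable_set_polytope: "stable E W \<Longrightarrow> rho W \<in> stable_set_polytope E"
  by (auto simp: stable_set_polytope_def intro: hull_inc)

lemma stable_set_polytope_ineqs:
  assumes "p \<in> stable_set_polytope E"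
  shows "0 \<le> p $ v" and "clique E C \<Longrightarrow> (\<Sum>v\<in>C. p $ v) \<le> 1"
proof -
  have "stable_set_polytope E \<subseteq> {p. 0 \<le> p $ v}"
    unfolding stable_set_polytope_def
    by (rule hull_minimal) (auto simp: rho_nth convex_def)
  with assms show "0 \<le> p $ v" by blast
  assume C: "clique E C"
  have "convex {p. (\<Sum>v\<in>C. p $ v) \<le> (1::real)}"
    unfolding convex_def by (auto simp: sum.distrib simp flip: sum_distrib_left intro: convex_bound_le)
  moreover have "(\<Sum>v\<in>C. rho W $ v) \<le> 1" if "stable E W" for W
    using card_clique_Int_stable_le[OF C that] by (simp add: rho_nth sum_of_bool_eq Int_def)
  ultimately have "stable_set_polytope E \<subseteq> {p. (\<Sum>v\<in>C. p $ v) \<le> 1}"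
    unfolding stable_set_polytope_def by (intro hull_minimal) auto
  with assms show "(\<Sum>v\<in>C. p $ v) \<le> 1" by blast
qed

lemma simple_graph_stable_empty: "simple_graph E \<Longrightarrow> stable E {}"
  by (auto simp: simple_graph_def stable_def)

lemma zero_in_stable_set_polytope: "simple_graph E \<Longrightarrow> 0 \<in> stable_set_polytope E"
  using rho_in_stable_set_polytope[OF simple_graph_stable_empty] by force

text \<open>The clique inequality for a clique of maximal weight. Domination by \<open>s * p\<close>
  is assumed instead of equality so that it applies to the positive part of a difference.\<close>

lemma max_clique_weight_le_scale:
  assumes "p \<in> stable_set_polytope E" and "0 \<le> s" and "\<And>v. real (a v) \<le> s * p $ v"
  shows "real (max_clique_weight E a) \<le> s"
proof -
  obtain C where C: "clique E C" "max_clique_weight E a = sum a C"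
    using max_clique_weight_attained by blast
  have "real (sum a C) \<le> (\<Sum>v\<in>C. s * p $ v)"
    unfolding of_nat_sum using assms(3) by (rule sum_mono)
  also have "\<dots> \<le> s * 1"
    unfolding sum_distrib_left[symmetric]
    by (rule mult_left_mono[OF stable_set_polytope_ineqs(2)[OF assms(1) C(1)] assms(2)])
  finally show ?thesis by (simp add: C(2))
qed

lemma sum_rho_stable_decomposition:
  assumes "stable_decomposition E a F"
  shows "(\<Sum>S\<in>#F. rho S) = (\<chi> v. real (a v))"
proof -
  have "(\<Sum>S\<in>#F. rho S) $ v = real (size {#S \<in># F. v \<in> S#})" for v
    by (induction F) (auto simp: rho_nth)
  then show ?thesis using assms by (simp add: vec_eq_iff stable_decomposition_def)
qed

lemma scaled_stable_set_polytope_memI: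
  fixes E :: "'v::finite set set"
  assumes "simple_graph E" and "stable_decomposable E" and "real (max_clique_weight E a) \<le> s"
  shows "(\<chi> v. real (a v)) \<in> (*\<^sub>R) s ` stable_set_polytope E"
proof -
  obtain F where F: "stable_decomposition E a F" "size F = max_clique_weight E a"
    using assms(2) unfolding stable_decomposable_def by blast
  have "(\<Sum>S\<in>#F. rho S) \<in> (*\<^sub>R) (real (size F)) ` stable_set_polytope E"
    using zero_in_stable_set_polytope[OF assms(1)] F(1)
    by (intro sum_mset_in_scaled_convex convex_stable_set_polytope)
      (auto simp: stable_decomposition_def intro: rho_in_stable_set_polytope)
  then obtain p where p: "p \<in> stable_set_polytope E"
    "(\<chi> v. real (a v)) = real (size F) *\<^sub>R p"
    unfolding sum_rho_stable_decomposition[OF F(1)] by blast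
  show ?thesis
  proof (cases "s = 0")
    case True
    then show ?thesis using p assms(3) F(2) by force
  next
    case False
    \<comment> \<open>The decomposition only reaches the dilate by \<open>size F\<close>; shrinking
      \<open>p\<close> towards 0 reaches the larger factor \<open>s\<close>.\<close>
    let ?u = "real (size F) / s"
    have s: "0 < s" using False assms(3) by linarith
    then have "?u *\<^sub>R p + (1 - ?u) *\<^sub>R 0 \<in> stable_set_polytope E"
      using assms(3) F(2)
      by (intro convexD[OF convex_stable_set_polytope p(1) zero_in_stable_set_polytope[OF assms(1)]]) auto
    moreover have "(\<chi> v. real (a v)) = s *\<^sub>R (?u *\<^sub>R p + (1 - ?u) *\<^sub>R 0)"
      using s by (simp add: p(2))
    ultimately show ?thesis by blast
  qed
qed

section \<open>Membership criteria for the dilates of Gamma and Omega\<close>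

definition pos_weight :: "'v::finite set set \<Rightarrow> ('v \<Rightarrow> int) \<Rightarrow> nat" where
  "pos_weight E z = max_clique_weight E (\<lambda>v. nat (z v))"

definition signed_weight :: "'v::finite set set \<Rightarrow> 'v set set \<Rightarrow> ('v \<Rightarrow> int) \<Rightarrow> nat" where
  "signed_weight E1 E2 z = pos_weight E1 z + pos_weight E2 (- z)"

text \<open>As \<open>s * p\<close> and \<open>t * q\<close> are nonnegative, they dominate the
  positive and negative parts of \<open>z\<close>. Conversely, these two parts are represented
  separately. The factors are real because Omega leads to half-integers.\<close>

lemma lattice_vec_difference_iff:
  fixes E1 E2 :: "'v::finite set set"
  assumes "simple_graph E1" "stable_decomposable E1" "simple_graph E2" "stable_decomposable E2"
    and "0 \<le> s" "0 \<le> t"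
  shows "(\<exists>p\<in>stable_set_polytope E1. \<exists>q\<in>stable_set_polytope E2.
      lattice_vec z = s *\<^sub>R p - t *\<^sub>R q) \<longleftrightarrow>
    real (pos_weight E1 z) \<le> s \<and> real (pos_weight E2 (- z)) \<le> t"
proof
  assume "\<exists>p\<in>stable_set_polytope E1. \<exists>q\<in>stable_set_polytope E2.
      lattice_vec z = s *\<^sub>R p - t *\<^sub>R q"
  then obtain p q where p: "p \<in> stable_set_polytope E1" and q: "q \<in> stable_set_polytope E2"
    and z: "lattice_vec z = s *\<^sub>R p - t *\<^sub>R q" by blast
  have z_eq: "of_int (z v) = s * p $ v - t * q $ v" for v
    using arg_cong[OF z, of "\<lambda>x. x $ v"] by simp
  have nonneg: "0 \<le> s * p $ v" "0 \<le> t * q $ v" for v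
    using assms(5,6) stable_set_polytope_ineqs(1)[OF p] stable_set_polytope_ineqs(1)[OF q] by simp_all
  have "real (nat (z v)) \<le> s * p $ v" "real (nat ((- z) v)) \<le> t * q $ v" for v
    using z_eq[of v] nonneg[of v] by (cases "z v \<ge> 0"; simp)+
  then show "real (pos_weight E1 z) \<le> s \<and> real (pos_weight E2 (- z)) \<le> t"
    unfolding pos_weight_def
    by (intro conjI max_clique_weight_le_scale[OF p assms(5)] max_clique_weight_le_scale[OF q assms(6)])
next
  assume *: "real (pos_weight E1 z) \<le> s \<and> real (pos_weight E2 (- z)) \<le> t"
  obtain p where p: "p \<in> stable_set_polytope E1" "(\<chi> v. real (nat (z v))) = s *\<^sub>R p"
    using scaled_stable_set_polytope_memI[OF assms(1,2)] * unfolding pos_weight_def by blast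
  obtain q where q: "q \<in> stable_set_polytope E2" "(\<chi> v. real (nat ((- z) v))) = t *\<^sub>R q"
    using scaled_stable_set_polytope_memI[OF assms(3,4)] * unfolding pos_weight_def by blast
  have "lattice_vec z = (\<chi> v. real (nat (z v))) - (\<chi> v. real (nat ((- z) v)))"
    by (auto simp: vec_eq_iff)
  then show "\<exists>p\<in>stable_set_polytope E1. \<exists>q\<in>stable_set_polytope E2.
      lattice_vec z = s *\<^sub>R p - t *\<^sub>R q"
    using p q by metis
qed

lemma lattice_vec_mem_Gamma_iff:
  fixes E1 E2 :: "'v::finite set set"
  assumes "simple_graph E1" "stable_decomposable E1" "simple_graph E2" "stable_decomposable E2"
  shows "lattice_vec z \<in> (*\<^sub>R) (real n) ` Gamma_polytope (stable_set_polytope E1) (stable_set_polytope E2)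
    \<longleftrightarrow> signed_weight E1 E2 z \<le> n"
proof -
  let ?P = "stable_set_polytope E1" and ?Q = "stable_set_polytope E2"
  have ne: "?P \<noteq> {}" "?Q \<noteq> {}"
    using zero_in_stable_set_polytope assms(1,3) by blast+
  have cQ: "convex (uminus ` ?Q)"
    by (intro convex_negations convex_stable_set_polytope)
  have "lattice_vec z \<in> (*\<^sub>R) (real n) ` Gamma_polytope ?P ?Q \<longleftrightarrow>
    (\<exists>s t p q. 0 \<le> s \<and> 0 \<le> t \<and> s + t = real n \<and> p \<in> ?P \<and> q \<in> uminus ` ?Q \<and>
      lattice_vec z = s *\<^sub>R p + t *\<^sub>R q)"
    unfolding Gamma_polytope_def
    by (rule scaled_convex_hull_union) (use ne cQ convex_stable_set_polytope in auto)
  also have "\<dots> \<longleftrightarrow> (\<exists>s t. 0 \<le> s \<and> 0 \<le> t \<and> s + t = real n \<and>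
      (\<exists>p\<in>?P. \<exists>q\<in>?Q. lattice_vec z = s *\<^sub>R p - t *\<^sub>R q))"
    by (auto simp: image_iff) (metis, force)
  also have "\<dots> \<longleftrightarrow> (\<exists>s t. 0 \<le> s \<and> 0 \<le> t \<and> s + t = real n \<and>
      real (pos_weight E1 z) \<le> s \<and> real (pos_weight E2 (- z)) \<le> t)"
    using lattice_vec_difference_iff[OF assms] by meson
  also have "\<dots> \<longleftrightarrow> signed_weight E1 E2 z \<le> n"
  proof
    assume "signed_weight E1 E2 z \<le> n"
    then have "real (pos_weight E1 z) + real (pos_weight E2 (- z)) \<le> real n"
      unfolding signed_weight_def by linarith
    then show "\<exists>s t. 0 \<le> s \<and> 0 \<le> t \<and> s + t = real n \<and>
      real (pos_weight E1 z) \<le> s \<and> real (pos_weight E2 (- z)) \<le> t"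
      \<comment> \<open>The first factor is taken as small as possible; the second receives the
        remaining slack.\<close>
      by (intro exI[of _ "real (pos_weight E1 z)"] exI[of _ "real n - real (pos_weight E1 z)"]) auto
  qed (auto simp: signed_weight_def)
  finally show ?thesis .
qed

lemma mem_at_height_iff: "y \<in> at_height t S \<longleftrightarrow> y $ None = t \<and> (\<chi> v. y $ Some v) \<in> S"
proof
  assume "y $ None = t \<and> (\<chi> v. y $ Some v) \<in> S"
  moreover from this have "y = (\<chi> i. case i of None \<Rightarrow> t | Some j \<Rightarrow> (\<chi> v. y $ Some v) $ j)"
    by (auto simp: vec_eq_iff split: option.split)
  ultimately show "y \<in> at_height t S" unfolding at_height_def by blast
qed (auto simp: at_height_def)

lemma convex_at_height:
  assumes "convex S" shows "convex (at_height t S)"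
proof (rule convexI)
  fix x y :: "real^('a option)" and u v :: real
  assume *: "x \<in> at_height t S" "y \<in> at_height t S" "0 \<le> u" "0 \<le> v" "u + v = 1"
  have "(\<chi> i. (u *\<^sub>R x + v *\<^sub>R y) $ Some i) = u *\<^sub>R (\<chi> i. x $ Some i) + v *\<^sub>R (\<chi> i. y $ Some i)"
    by (simp add: vec_eq_iff)
  also have "\<dots> \<in> S"
    using * by (intro convexD[OF assms]) (auto simp: mem_at_height_iff)
  finally show "u *\<^sub>R x + v *\<^sub>R y \<in> at_height t S"
    using * by (simp add: mem_at_height_iff flip: distrib_right)
qed

text \<open>The last coordinate prescribes \<open>s - t\<close>. Together with
  \<open>s + t = n\<close> this determines both factors, in contrast to Gamma, where the split of
  \<open>n\<close> is free.\<close>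

lemma lattice_vec_mem_Omega_iff:
  fixes E1 E2 :: "'v::finite set set" and y :: "'v option \<Rightarrow> int"
  assumes "simple_graph E1" "stable_decomposable E1" "simple_graph E2" "stable_decomposable E2"
  shows "lattice_vec y \<in> (*\<^sub>R) (real n) ` Omega_polytope (stable_set_polytope E1) (stable_set_polytope E2)
    \<longleftrightarrow> 2 * int (pos_weight E1 (\<lambda>v. y (Some v))) \<le> int n + y None \<and>
        2 * int (pos_weight E2 (- (\<lambda>v. y (Some v)))) \<le> int n - y None"
    (is "_ \<longleftrightarrow> ?R")
proof -
  let ?P = "stable_set_polytope E1" and ?Q = "stable_set_polytope E2"
  let ?z = "\<lambda>v. y (Some v)"
  have ne: "?P \<noteq> {}" "?Q \<noteq> {}"
    using zero_in_stable_set_polytope assms(1,3) by blast+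
  have neh: "at_height t S \<noteq> {}" if "S \<noteq> {}" for t and S :: "(real^'v) set"
    using that by (auto simp: at_height_def)
  have cQ: "convex (uminus ` ?Q)"
    by (intro convex_negations convex_stable_set_polytope)
  have "lattice_vec y \<in> (*\<^sub>R) (real n) ` Omega_polytope ?P ?Q \<longleftrightarrow>
    (\<exists>s t p q. 0 \<le> s \<and> 0 \<le> t \<and> s + t = real n \<and> p \<in> at_height 1 ?P \<and>
      q \<in> at_height (-1) (uminus ` ?Q) \<and> lattice_vec y = s *\<^sub>R p + t *\<^sub>R q)"
    unfolding Omega_polytope_def
    by (intro scaled_convex_hull_union convex_at_height neh cQ convex_stable_set_polytope)
      (use ne in auto)
  also have "\<dots> \<longleftrightarrow> (\<exists>s t. 0 \<le> s \<and> 0 \<le> t \<and> s + t = real n \<and> s - t = of_int (y None) \<and>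
      (\<exists>p\<in>?P. \<exists>q\<in>?Q. lattice_vec ?z = s *\<^sub>R p - t *\<^sub>R q))" (is "?A \<longleftrightarrow> ?B")
  proof
    assume ?A
    then obtain s t p q where *: "0 \<le> s" "0 \<le> t" "s + t = real n" "p \<in> at_height 1 ?P"
      "q \<in> at_height (-1) (uminus ` ?Q)" "lattice_vec y = s *\<^sub>R p + t *\<^sub>R q" by blast
    obtain q' where q': "q' \<in> ?Q" "(\<chi> v. q $ Some v) = - q'"
      using *(5) by (auto simp: mem_at_height_iff)
    have comp: "of_int (y i) = s * p $ i + t * q $ i" for i
      using arg_cong[OF *(6), of "\<lambda>x. x $ i"] by simp
    have "q $ Some v = - q' $ v" for v
      using arg_cong[OF q'(2), of "\<lambda>x. x $ v"] by simp
    then have "lattice_vec ?z = s *\<^sub>R (\<chi> v. p $ Some v) - t *\<^sub>R q'"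
      by (simp add: vec_eq_iff comp)
    moreover have "s - t = of_int (y None)"
      using comp[of None] *(4,5) by (simp add: mem_at_height_iff)
    ultimately show ?B using * q'(1) unfolding mem_at_height_iff by blast
  next
    assume ?B
    then obtain s t p q where *: "0 \<le> s" "0 \<le> t" "s + t = real n" "s - t = of_int (y None)"
      "p \<in> ?P" "q \<in> ?Q" "lattice_vec ?z = s *\<^sub>R p - t *\<^sub>R q" by blast
    have comp: "of_int (y (Some i)) = s * p $ i - t * q $ i" for i
      using arg_cong[OF *(7), of "\<lambda>x. x $ i"] by simp
    let ?p = "\<chi> i. case i of None \<Rightarrow> 1 | Some j \<Rightarrow> p $ j"
    let ?q = "\<chi> i. case i of None \<Rightarrow> -1 | Some j \<Rightarrow> (- q) $ j"
    have "?p \<in> at_height 1 ?P" "?q \<in> at_height (-1) (uminus ` ?Q)"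
      using *(5,6) unfolding at_height_def by blast+
    moreover have "lattice_vec y = s *\<^sub>R ?p + t *\<^sub>R ?q"
      using *(4) by (auto simp: vec_eq_iff comp split: option.split)
    ultimately show ?A using *(1-3) by blast
  qed
  also have "\<dots> \<longleftrightarrow> (\<exists>s t. 0 \<le> s \<and> 0 \<le> t \<and> s + t = real n \<and> s - t = of_int (y None) \<and>
      real (pos_weight E1 ?z) \<le> s \<and> real (pos_weight E2 (- ?z)) \<le> t)"
    using lattice_vec_difference_iff[OF assms] by meson
  also have "\<dots> \<longleftrightarrow> 2 * real (pos_weight E1 ?z) \<le> real n + of_int (y None) \<and>
      2 * real (pos_weight E2 (- ?z)) \<le> real n - of_int (y None)" (is "?C \<longleftrightarrow> ?D")
  proof
    assume ?D
    then show ?C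
      by (intro exI[of _ "(real n + of_int (y None)) / 2"] exI[of _ "(real n - of_int (y None)) / 2"])
        (auto simp: field_simps)
  qed auto
  also have "\<dots> \<longleftrightarrow> ?R"
    by linarith
  finally show ?thesis .
qed

section \<open>Counting lattice points fibrewise\<close>

lemma pos_weight_ge: "z v \<le> int (pos_weight E z)"
  using weight_le_max_clique_weight[of "\<lambda>v. nat (z v)" v E] by (simp add: pos_weight_def)

lemma signed_weight_le_subset:
  "{z. signed_weight E1 E2 z \<le> n} \<subseteq> PiE UNIV (\<lambda>_. {- int n..int n})"
proof
  fix z assume "z \<in> {z. signed_weight E1 E2 z \<le> n}"
  then have "z v \<le> int n" "- z v \<le> int n" for v
    using pos_weight_ge[of z v E1] pos_weight_ge[of "- z" v E2] by (auto simp: signed_weight_def)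
  then show "z \<in> PiE UNIV (\<lambda>_. {- int n..int n})"
    by (simp add: PiE_iff) (metis minus_le_iff)
qed

lemma finite_signed_weight_le [simp]: "finite {z. signed_weight E1 E2 z \<le> n}"
  by (rule finite_subset[OF signed_weight_le_subset]) (simp add: finite_PiE)

text \<open>The exponent \<open>CARD('v)\<close> here is what yields the power
  \<open>CARD('v) + 1\<close> of \<open>1 - fps_X\<close> in the rationality statement.\<close>

lemma card_signed_weight_le:
  fixes E1 E2 :: "'v::finite set set"
  shows "card {z. signed_weight E1 E2 z \<le> n} \<le> 2 ^ CARD('v) * (n + 1) ^ CARD('v)"
proof -
  have "card {z. signed_weight E1 E2 z \<le> n} \<le> card (PiE (UNIV :: 'v set) (\<lambda>_. {- int n..int n}))"
    by (rule card_mono[OF _ signed_weight_le_subset]) (simp add: finite_PiE)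
  also have "\<dots> = (2 * n + 1) ^ CARD('v)"
  proof -
    have "card {- int n..int n} = 2 * n + 1" by simp
    then show ?thesis by (simp only: card_PiE[OF finite] prod_constant)
  qed
  also have "\<dots> \<le> (2 * (n + 1)) ^ CARD('v)"
    by (rule power_mono) auto
  finally show ?thesis by (simp only: power_mult_distrib)
qed

lemma card_option_fun_fibers:
  fixes B :: "('v::finite \<Rightarrow> int) \<Rightarrow> int set"
  assumes "finite Z" and "\<And>z. finite (B z)" and "\<And>z. z \<notin> Z \<Longrightarrow> B z = {}"
  shows "card {y. y None \<in> B (\<lambda>v. y (Some v))} = (\<Sum>z\<in>Z. card (B z))"
proof -
  have "bij_betw (\<lambda>y. (\<lambda>v. y (Some v), y None)) {y. y None \<in> B (\<lambda>v. y (Some v))} (SIGMA z:Z. B z)"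
  proof (rule bij_betw_byWitness[where f' = "\<lambda>(z, r) i. case i of None \<Rightarrow> r | Some v \<Rightarrow> z v"])
    show "\<forall>y\<in>{y. y None \<in> B (\<lambda>v. y (Some v))}.
      (case (\<lambda>v. y (Some v), y None) of (z, r) \<Rightarrow> \<lambda>i. case i of None \<Rightarrow> r | Some v \<Rightarrow> z v) = y"
      by (auto simp: fun_eq_iff split: option.split)
    show "(\<lambda>y. (\<lambda>v. y (Some v), y None)) ` {y. y None \<in> B (\<lambda>v. y (Some v))} \<subseteq> (SIGMA z:Z. B z)"
      using assms(3) by auto
  qed auto
  then show ?thesis
    using assms(1,2) by (simp add: bij_betw_same_card card_SigmaI)
qed

lemma ehrhart_count_Gamma:
  fixes E1 E2 :: "'v::finite set set"
  assumes "simple_graph E1" "stable_decomposable E1" "simple_graph E2" "stable_decomposable E2"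
  shows "ehrhart_count (Gamma_polytope (stable_set_polytope E1) (stable_set_polytope E2)) n =
    card {z. signed_weight E1 E2 z \<le> n}"
  unfolding ehrhart_count_eq lattice_vec_mem_Gamma_iff[OF assms] ..

lemma ehrhart_count_Omega:
  fixes E1 E2 :: "'v::finite set set"
  assumes "simple_graph E1" "stable_decomposable E1" "simple_graph E2" "stable_decomposable E2"
  shows "ehrhart_count (Omega_polytope (stable_set_polytope E1) (stable_set_polytope E2)) n =
    (\<Sum>z | signed_weight E1 E2 z \<le> n. 2 * (n - signed_weight E1 E2 z) + 1)"
proof -
  let ?B = "\<lambda>z. {2 * int (pos_weight E1 z) - int n..int n - 2 * int (pos_weight E2 (- z))}"
  have "ehrhart_count (Omega_polytope (stable_set_polytope E1) (stable_set_polytope E2)) n =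
      card {y. y None \<in> ?B (\<lambda>v. y (Some v))}"
    unfolding ehrhart_count_eq lattice_vec_mem_Omega_iff[OF assms]
    by (rule arg_cong[of _ _ card]) auto
  \<comment> \<open>Upper minus lower end of \<open>?B z\<close> is twice \<open>n\<close> minus the
    signed weight, so the fibre is empty exactly when that weight exceeds \<open>n\<close>.\<close>
  also have "\<dots> = (\<Sum>z | signed_weight E1 E2 z \<le> n. card (?B z))"
    by (rule card_option_fun_fibers[OF finite_signed_weight_le]) (auto simp: signed_weight_def)
  also have "\<dots> = (\<Sum>z | signed_weight E1 E2 z \<le> n. 2 * (n - signed_weight E1 E2 z) + 1)"
    by (rule sum.cong) (auto simp: signed_weight_def)
  finally show ?thesis .
qed

lemma simple_graph_suspension: "simple_graph E \<Longrightarrow> simple_graph (suspension E)"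
  by (auto simp: simple_graph_def suspension_def card_image)

text \<open>The apex adds the positive part of \<open>y None\<close> to one summand and its negative
  part to the other, in total the absolute value.\<close>

lemma signed_weight_suspension:
  "signed_weight (suspension E1) (suspension E2) y =
    signed_weight E1 E2 (\<lambda>v. y (Some v)) + nat \<bar>y None\<bar>"
  by (simp add: signed_weight_def pos_weight_def max_clique_weight_suspension fun_Compl_def)

lemma ehrhart_count_Gamma_suspension:
  fixes E1 E2 :: "'v::finite set set"
  assumes "simple_graph E1" "stable_decomposable E1" "simple_graph E2" "stable_decomposable E2"
  shows "ehrhart_count (Gamma_polytope (stable_set_polytope (suspension E1))
      (stable_set_polytope (suspension E2))) n =
    (\<Sum>z | signed_weight E1 E2 z \<le> n. 2 * (n - signed_weight E1 E2 z) + 1)"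
proof -
  let ?B = "\<lambda>z. {- (int n - int (signed_weight E1 E2 z))..int n - int (signed_weight E1 E2 z)}"
  have "ehrhart_count (Gamma_polytope (stable_set_polytope (suspension E1))
      (stable_set_polytope (suspension E2))) n = card {y. y None \<in> ?B (\<lambda>v. y (Some v))}"
    by (subst ehrhart_count_Gamma) (auto simp: assms simple_graph_suspension
        stable_decomposable_suspension signed_weight_suspension intro!: arg_cong[of _ _ card])
  also have "\<dots> = (\<Sum>z | signed_weight E1 E2 z \<le> n. card (?B z))"
    by (rule card_option_fun_fibers) auto
  also have "\<dots> = (\<Sum>z | signed_weight E1 E2 z \<le> n. 2 * (n - signed_weight E1 E2 z) + 1)"
    by (rule sum.cong) auto
  finally show ?thesis .
qed

section \<open>Generating functions and the final comparison\<close>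

lemma sum_weight_deficit_Suc:
  fixes h :: "'a \<Rightarrow> nat"
  assumes "\<And>n. finite {z. h z \<le> n}"
  shows "(\<Sum>z | h z \<le> Suc n. 2 * (Suc n - h z) + 1) =
    (\<Sum>z | h z \<le> n. 2 * (n - h z) + 1) + card {z. h z \<le> n} + card {z. h z \<le> Suc n}"
proof -
  have split: "{z. h z \<le> Suc n} = {z. h z \<le> n} \<union> {z. h z = Suc n}" by auto
  have fin: "finite {z. h z = Suc n}"
    by (rule finite_subset[OF _ assms[of "Suc n"]]) auto
  have "(\<Sum>z | h z \<le> Suc n. 2 * (Suc n - h z) + 1) =
      (\<Sum>z | h z \<le> n. 2 * (Suc n - h z) + 1) + (\<Sum>z | h z = Suc n. 2 * (Suc n - h z) + 1)"
    unfolding split by (rule sum.union_disjoint) (use assms fin in auto)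
  \<comment> \<open>Each old point gains 2 and each new point contributes 1; one of the two gains
    joins the new points to form the count at \<open>Suc n\<close>.\<close>
  also have "(\<Sum>z | h z \<le> n. 2 * (Suc n - h z) + 1) = (\<Sum>z | h z \<le> n. (2 * (n - h z) + 1) + 2)"
    by (rule sum.cong) auto
  also have "\<dots> = (\<Sum>z | h z \<le> n. 2 * (n - h z) + 1) + 2 * card {z. h z \<le> n}"
    by (subst sum.distrib) simp
  also have "(\<Sum>z | h z = Suc n. 2 * (Suc n - h z) + 1) = card {z. h z = Suc n}"
    by simp
  moreover have "card {z. h z \<le> Suc n} = card {z. h z \<le> n} + card {z. h z = Suc n}"
    unfolding split by (rule card_Un_disjoint) (use assms fin in auto)
  ultimately show ?thesis by simp
qed

lemma deficit_series:
  fixes h :: "'a \<Rightarrow> nat"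
  assumes "\<And>n. finite {z. h z \<le> n}"
  shows "(1 - fps_X) * Abs_fps (\<lambda>n. int (\<Sum>z | h z \<le> n. 2 * (n - h z) + 1)) =
    (1 + fps_X) * Abs_fps (\<lambda>n. int (card {z. h z \<le> n}))"
proof (rule fps_ext)
  fix n
  show "fps_nth ((1 - fps_X) * Abs_fps (\<lambda>n. int (\<Sum>z | h z \<le> n. 2 * (n - h z) + 1))) n =
    fps_nth ((1 + fps_X) * Abs_fps (\<lambda>n. int (card {z. h z \<le> n}))) n"
  proof (cases n)
    case 0
    then show ?thesis by (simp add: left_diff_distrib distrib_right)
  next
    case (Suc m)
    show ?thesis
      unfolding Suc left_diff_distrib distrib_right
      using sum_weight_deficit_Suc[OF assms, of m] by (simp del: of_nat_sum)
  qed
qed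

text \<open>The integer decomposition property: the lattice points of the n-th dilate are exactly
  the n-fold sums from the finite set \<open>A\<close>, so the sumset theorem applies.\<close>

lemma Gamma_series_rational:
  fixes E1 E2 :: "'v::finite set set"
  assumes "simple_graph E1" "stable_decomposable E1" "simple_graph E2" "stable_decomposable E2"
  shows "\<exists>p. fps_of_poly p =
    (1 - fps_X) ^ (CARD('v) + 1) * Abs_fps (\<lambda>n. int (card {z. signed_weight E1 E2 z \<le> n}))"
proof -
  let ?G = "Gamma_polytope (stable_set_polytope E1) (stable_set_polytope E2)"
  define A where "A = rho ` {W. stable E1 W} \<union> uminus ` rho ` {W. stable E2 W}"
  have A_G: "A \<subseteq> ?G"
    unfolding A_def Gamma_polytope_def
    by (rule subset_trans[OF _ hull_subset]) (auto intro: rho_in_stable_set_polytope)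
  have A_Z: "A \<subseteq> integer_lattice"
    by (auto simp: A_def integer_lattice_def rho_nth)
  have sum_Z: "sum_mset w \<in> integer_lattice" if "set_mset w \<subseteq> integer_lattice" for w :: "(real^'v) multiset"
    using that by (induction w) (auto simp: integer_lattice_def)
  have "sum_mset ` multisets_of_size A n = lattice_vec ` {z. signed_weight E1 E2 z \<le> n}" for n
  proof (intro equalityI subsetI)
    fix x assume "x \<in> sum_mset ` multisets_of_size A n"
    then obtain w where w: "set_mset w \<subseteq> A" "size w = n" "x = sum_mset w"
      by (auto simp: multisets_of_size_def)
    have "(\<Sum>y\<in>#w. y) \<in> (*\<^sub>R) (real (size w)) ` ?G"
      using w(1) A_G zero_in_stable_set_polytope[OF assms(1)]
      by (intro sum_mset_in_scaled_convex) (auto simp: Gamma_polytope_def)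
    moreover obtain z where z: "x = lattice_vec z"
      using sum_Z[of w] w(1,3) A_Z range_lattice_vec by blast
    ultimately show "x \<in> lattice_vec ` {z. signed_weight E1 E2 z \<le> n}"
      using lattice_vec_mem_Gamma_iff[OF assms] w by simp
  next
    fix x assume "x \<in> lattice_vec ` {z. signed_weight E1 E2 z \<le> n}"
    then obtain z where z: "signed_weight E1 E2 z \<le> n" "x = lattice_vec z" by blast
    obtain F where F: "stable_decomposition E1 (\<lambda>v. nat (z v)) F" "size F = pos_weight E1 z"
      using assms(2) unfolding stable_decomposable_def pos_weight_def by blast
    obtain H where H: "stable_decomposition E2 (\<lambda>v. nat ((- z) v)) H" "size H = pos_weight E2 (- z)"
      using assms(4) unfolding stable_decomposable_def pos_weight_def by blast
    \<comment> \<open>Decompositions of the positive and negative parts of \<open>z\<close>, padded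
      with zero vectors \<open>rho {}\<close> to exactly \<open>n\<close> summands.\<close>
    define w where "w = image_mset rho F + image_mset (\<lambda>S. - rho S) H +
      replicate_mset (n - signed_weight E1 E2 z) (rho {})"
    have "(\<Sum>S\<in>#H. - rho S) = - (\<Sum>S\<in>#H. rho S)"
      by (induction H) auto
    then have "sum_mset w = (\<chi> v. real (nat (z v))) - (\<chi> v. real (nat ((- z) v)))"
      unfolding w_def by (simp add: sum_rho_stable_decomposition[OF F(1)]
          sum_rho_stable_decomposition[OF H(1)])
    also have "\<dots> = x" by (auto simp: z(2) vec_eq_iff)
    finally have "sum_mset w = x" .
    moreover have "size w = n"
      using z(1) by (simp add: w_def F(2) H(2) signed_weight_def)
    moreover have "set_mset w \<subseteq> A"
      using F(1) H(1) simple_graph_stable_empty[OF assms(1)]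
      by (auto simp: w_def A_def stable_decomposition_def simp del: rho_empty split: if_splits)
    ultimately show "x \<in> sum_mset ` multisets_of_size A n"
      by (auto simp: multisets_of_size_def)
  qed
  then have "card (sum_mset ` multisets_of_size A n) = card {z. signed_weight E1 E2 z \<le> n}" for n
    by (simp add: card_image inj_on_subset[OF inj_lattice_vec])
  moreover have "finite A" by (simp add: A_def)
  ultimately show ?thesis
    using sumset_series_rational[of A "2 ^ CARD('v)" "CARD('v)"] card_signed_weight_le[of E1 E2] by simp
qed

theorem theorem1p2:
  fixes G1 G2 :: "'v::finite set set"
  assumes "simple_graph G1" and "simple_graph G2"
    and "perfect_graph G1" and "perfect_graph G2"
  shows
    "delta_poly (Omega_polytope (stable_set_polytope G1) (stable_set_polytope G2)) =
       delta_poly (Gamma_polytope (stable_set_polytope (suspension G1))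
                                  (stable_set_polytope (suspension G2))) \<and>
     delta_poly (Gamma_polytope (stable_set_polytope (suspension G1))
                                (stable_set_polytope (suspension G2))) =
       [:1, 1:] * delta_poly (Gamma_polytope (stable_set_polytope G1) (stable_set_polytope G2)) \<and>
     normalized_volume (Omega_polytope (stable_set_polytope G1) (stable_set_polytope G2)) =
       normalized_volume (Gamma_polytope (stable_set_polytope (suspension G1))
                                         (stable_set_polytope (suspension G2))) \<and>
     normalized_volume (Gamma_polytope (stable_set_polytope (suspension G1))
                                       (stable_set_polytope (suspension G2))) =
       2 * normalized_volume (Gamma_polytope (stable_set_polytope G1) (stable_set_polytope G2))"
proof -
  let ?Gamma = "Gamma_polytope (stable_set_polytope G1) (stable_set_polytope G2)"
  let ?Omega = "Omega_polytope (stable_set_polytope G1) (stable_set_polytope G2)"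
  let ?Susp = "Gamma_polytope (stable_set_polytope (suspension G1)) (stable_set_polytope (suspension G2))"
  let ?h = "signed_weight G1 G2"
  have dec: "stable_decomposable G1" "stable_decomposable G2"
    using assms perfect_imp_stable_decomposable by blast+
  note G = assms(1) dec(1) assms(2) dec(2)
  have ne: "?Gamma \<noteq> {}" "?Omega \<noteq> {}" "?Susp \<noteq> {}"
    using zero_in_stable_set_polytope[OF assms(1)]
      zero_in_stable_set_polytope[OF simple_graph_suspension[OF assms(1)]]
    by (auto simp: Gamma_polytope_def Omega_polytope_def at_height_def)
  obtain p where p: "fps_of_poly p =
      (1 - fps_X) ^ (CARD('v) + 1) * Abs_fps (\<lambda>n. int (card {z. ?h z \<le> n}))"
    using Gamma_series_rational[OF G] by blast
  let ?D = "Abs_fps (\<lambda>n. int (\<Sum>z | ?h z \<le> n. 2 * (n - ?h z) + 1))"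
  have X: "fps_of_poly [:1, 1:] = (1 + fps_X :: int fps)"
    by (auto simp: fps_eq_iff coeff_pCons fps_X_def split: nat.split)
  have "fps_of_poly ([:1, 1:] * p) = (1 - fps_X) ^ (CARD('v) + 1) *
      ((1 + fps_X) * Abs_fps (\<lambda>n. int (card {z. ?h z \<le> n})))"
    by (simp only: fps_of_poly_mult X p ac_simps)
  \<comment> \<open>The additional coordinate supplies one more factor \<open>1 - fps_X\<close>,
    which \<open>deficit_series\<close> trades for \<open>1 + fps_X\<close>.\<close>
  also have "\<dots> = (1 - fps_X) ^ (CARD('v option) + 1) * ?D"
    unfolding deficit_series[OF finite_signed_weight_le, symmetric] by (simp add: ac_simps)
  finally have q: "fps_of_poly ([:1, 1:] * p) = (1 - fps_X) ^ (CARD('v option) + 1) * ?D" .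
  have "delta_poly ?Gamma = p"
    by (rule delta_poly_eqI) (simp only: ehrhart_series_eq[OF ne(1)] ehrhart_count_Gamma[OF G] p)
  moreover have "delta_poly ?Omega = [:1, 1:] * p"
    by (rule delta_poly_eqI) (simp only: ehrhart_series_eq[OF ne(2)] ehrhart_count_Omega[OF G] q)
  moreover have "delta_poly ?Susp = [:1, 1:] * p"
    by (rule delta_poly_eqI) (simp only: ehrhart_series_eq[OF ne(3)] ehrhart_count_Gamma_suspension[OF G] q)
  \<comment> \<open>At 1 the factor \<open>[:1, 1:]\<close> evaluates to 2, which gives the volume
    identities.\<close>
  ultimately show ?thesis
    unfolding normalized_volume_def by simp
qed

end
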